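(* For any given $x\in(0,\infty)$, as $n\to\infty$, $$\mathrm{MSE}(\hat F_{n,b}^{\mathrm{IGam}}(x)) = \mathrm{Var}(\hat F_{n,b}^{\mathrm{IGam}}(x))+\big(\mathrm{Bias}[\hat F_{n,b}^{\mathrm{IGam}}(x)]\big)^2$$ $$= n^{-1}F(x)(1-F(x)) - n^{-1}b^{1/2}\cdot\frac{x f(x)}{\sqrt{\pi}} + b^2\cdot\frac{x^4}{4}(f'(x))^2+O_x(n^{-1}b)+o_x(b^2).$$ In particular, if $f(x)\cdot f'(x)\neq0$, the asymptotically optimal choice of $b$, with respect to $\mathrm{MSE}$, is $$b_{\mathrm{opt}} = n^{-2/3}\left[\frac{4\cdot\frac{x^4}{4}(f'(x))^2}{x f(x)/\sqrt{\pi}}\right]^{-2/3},$$ with $$\mathrm{MSE}(\hat F_{n,b_{\mathrm{opt}}}^{\mathrm{IGam}}(x)) = n^{-1}F(x)(1-F(x)) - n^{-4/3}\,\frac34\left[\frac{(x f(x)/\sqrt{\pi})^4}{4\cdot\frac{x^4}{4}(f'(x))^2}\right]^{1/3}+o_x(n^{-4/3}).$$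
   Context: $F$ is a cumulative distribution function supported on $[0,\infty)$ having two continuous and bounded derivatives; $f=F'$. $X_1,X_2,\dots$ are i.i.d. with c.d.f. $F$. The smoothing parameter $b=b_n>0$ satisfies $b\to0$ as $n\to\infty$. The inverse Gamma kernel c.d.f. estimator is $$\hat F_{n,b}^{\mathrm{IGam}}(x):=\frac1n\sum_{i=1}^n\overline K_{\mathrm{IGam}}(X_i\mid b^{-1}+1,\,x^{-1}b),\qquad \overline K_{\mathrm{IGam}}(t\mid\alpha,\theta):=1-\frac{\Gamma(\alpha,1/(t\theta))}{\Gamma(\alpha)},\quad \alpha,\theta>0,$$ where $\Gamma(\alpha,z):=\int_z^\infty t^{\alpha-1}e^{-t}\,dt$ and $\Gamma(\alpha):=\Gamma(\alpha,0)$. For an estimator $\hat F$, $\mathrm{Bias}[\hat F(x)]:=\mathbb{E}[\hat F(x)]-F(x)$ and $\mathrm{MSE}(\hat F(x)):=\mathbb{E}[(\hat F(x)-F(x))^2]$. "Asymptotically optimal choice of $b$ with respect to MSE" means the minimizer over $b>0$ of the expansion of the MSE with the error terms $O_x(n^{-1}b)$ and $o_x(b^2)$ dropped. Notation: $u=O(v)$ means $\limsup|u/v|<C<\infty$ as $n\to\infty$, where $C$ may depend on $F$ but on no other variable unless written as a subscript ($O_x$ allows dependence on $x$); $u=o(v)$ means $\lim|u/v|=0$ as $n\to\infty$, with the same rule for subscripts. *)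

theory Defs
  imports "HOL-Probability.Probability" "HOL-Library.Landau_Symbols"
begin

definition upper_Gamma :: "real \<Rightarrow> real \<Rightarrow> real" where
  "upper_Gamma \<alpha> z = (LINT t:{z..}|lborel. t powr (\<alpha> - 1) * exp (- t))"

text \<open>
  The survival function of the inverse Gamma distribution. For \<open>t > 0\<close> tending to 0
  the argument \<open>1 / (t * \<theta>)\<close> tends to infinity and the value tends to 1; the branch
  \<open>t \<le> 0\<close> makes this explicit, since \<open>1 / 0 = 0\<close> would otherwise give the value 0 at
  \<open>t = 0\<close>.
\<close>

definition IGam_survival :: "real \<Rightarrow> real \<Rightarrow> real \<Rightarrow> real" where
  "IGam_survival \<alpha> \<theta> t =
     (if t > 0 then 1 - upper_Gamma \<alpha> (1 / (t * \<theta>)) / Gamma \<alpha> else 1)"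

text \<open>The observations are \<open>X 1, X 2, \<dots>\<close>; the value \<open>X 0\<close> is not used.\<close>

definition IGam_cdf_estimator ::
  "(nat \<Rightarrow> 'a \<Rightarrow> real) \<Rightarrow> nat \<Rightarrow> real \<Rightarrow> real \<Rightarrow> 'a \<Rightarrow> real" where
  "IGam_cdf_estimator X n b x \<omega> =
     1 / real n * (\<Sum>i = 1..n. IGam_survival (1 / b + 1) (b / x) (X i \<omega>))"

definition Bias :: "'a measure \<Rightarrow> ('a \<Rightarrow> real) \<Rightarrow> real \<Rightarrow> real" where
  "Bias M Y \<theta> = prob_space.expectation M Y - \<theta>"

definition MSE :: "'a measure \<Rightarrow> ('a \<Rightarrow> real) \<Rightarrow> real \<Rightarrow> real" where
  "MSE M Y \<theta> = prob_space.expectation M (\<lambda>\<omega>. (Y \<omega> - \<theta>)\<^sup>2)"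

text \<open>
  The expansion of the mean squared error at \<open>x\<close> without its error terms; \<open>f\<close> and \<open>f'\<close>
  stand for the first and second derivative of \<open>F\<close>.
\<close>

definition IGam_leading_MSE ::
  "(real \<Rightarrow> real) \<Rightarrow> (real \<Rightarrow> real) \<Rightarrow> (real \<Rightarrow> real) \<Rightarrow> real \<Rightarrow> nat \<Rightarrow> real \<Rightarrow> real" where
  "IGam_leading_MSE F f f' x n b =
     1 / real n * (F x * (1 - F x))
     - 1 / real n * b powr (1 / 2) * (x * f x / sqrt pi)
     + b\<^sup>2 * (x ^ 4 / 4 * (f' x)\<^sup>2)"

definition IGam_b_opt ::
  "(real \<Rightarrow> real) \<Rightarrow> (real \<Rightarrow> real) \<Rightarrow> real \<Rightarrow> nat \<Rightarrow> real" where
  "IGam_b_opt f f' x n =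
     real n powr (- 2 / 3)
     * (4 * (x ^ 4 / 4 * (f' x)\<^sup>2) / (x * f x / sqrt pi)) powr (- 2 / 3)"

end

theory Submission
  imports Defs "HOL-Real_Asymp.Real_Asymp"
begin

text \<open>
  With \<open>a = 1 / b\<close> the kernel is the survival function of \<open>T = a x / G\<close>, where \<open>G\<close> has the Gamma
  distribution with shape \<open>a + 1\<close>. For an observation \<open>X\<close> independent of \<open>T\<close> and of a copy \<open>T'\<close> of
  \<open>T\<close>, the first two moments of the kernel at \<open>X\<close> are therefore \<open>E F(T)\<close> and \<open>E F(min T T')\<close>.
  Since \<open>E T = x\<close> and \<open>Var T = x\<^sup>2 / (a - 1)\<close>, Taylor expansion of \<open>F\<close> at \<open>x\<close> gives the bias; the
  remainder is controlled by the fourth central moment of \<open>T\<close>, which is \<open>O(b\<^sup>2)\<close>. The term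
  of order \<open>b\<^sup>1\<^sup>/\<^sup>2\<close> in the variance comes from
  \<open>E (min T T') = x - x / sqrt pi * Gamma (a + 1/2) / Gamma (a + 1)\<close>, where the quotient is
  \<open>b\<^sup>1\<^sup>/\<^sup>2 + O(b)\<close> because \<open>Gamma\<close> is log-convex.
\<close>

section \<open>Gamma densities\<close>

text \<open>No random variable \<open>T\<close> is ever constructed: an integral against
  \<open>gamma_density\<close> with \<open>c / g\<close> in place of \<open>T\<close> plays the role
  of the expectation. As \<open>min T T'\<close> is \<open>a x\<close> divided by the larger of two
  Gamma variables, the second moment of the kernel is an integral against the density of a maximum.
  The first-order Taylor term explains the two scales: it vanishes for \<open>T\<close>, whose mean
  is exactly \<open>x\<close>, but not for \<open>min T T'\<close>, whose mean falls short of
  \<open>x\<close> by an amount of the order of the standard deviation of \<open>T\<close>, that is,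
  of \<open>sqrt b\<close>.

  The constant of the O-term must be chosen before the bandwidth sequence. The variance is therefore
  treated by explicit inequalities for all \<open>b\<close> up to 1/4. The bias admits no such rate,
  because \<open>f'\<close> is merely continuous: for every \<open>\<epsilon>\<close> the Taylor
  remainder is split into an \<open>\<epsilon>\<close>-fraction of the variance of \<open>T\<close>
  and a multiple of its fourth central moment, and only the limit of bias over \<open>b\<close>
  results.\<close>

definition gamma_density :: "real \<Rightarrow> real \<Rightarrow> real" where
  "gamma_density s g = max 0 g powr (s - 1) * exp (- g) / Gamma s"

definition gamma_cdf :: "real \<Rightarrow> real \<Rightarrow> real" where
  "gamma_cdf s y = (LINT g:{..y}|lborel. gamma_density s g)"

lemma Gamma_real_neq_0 [simp]: "s > 0 \<Longrightarrow> Gamma (s :: real) \<noteq> 0"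
  by (metis Gamma_real_pos less_irrefl)

lemma gamma_density_nonneg: "s > 0 \<Longrightarrow> 0 \<le> gamma_density s g"
  by (simp add: gamma_density_def)

lemma gamma_density_nonpos: "g \<le> 0 \<Longrightarrow> gamma_density s g = 0"
  by (simp add: gamma_density_def max_def)

lemma gamma_density_measurable [measurable]: "gamma_density s \<in> borel_measurable borel"
  unfolding gamma_density_def by measurable

lemma has_bochner_integral_gamma_density:
  assumes "s > 0"
  shows "has_bochner_integral lborel (gamma_density s) 1"
proof (rule has_bochner_integral_nn_integral)
  have "(\<integral>\<^sup>+ g. ennreal (gamma_density s g) \<partial>lborel) =
      (\<integral>\<^sup>+ g. ennreal (1 / Gamma s) * ennreal (indicator {0..} g * g powr (s - 1) / exp g) \<partial>lborel)"
    using assms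
    by (intro nn_integral_cong, subst ennreal_mult'[symmetric])
       (auto simp: gamma_density_def indicator_def exp_minus field_simps max_def)
  also have "\<dots> = ennreal (1 / Gamma s) * ennreal (Gamma s)"
    using assms by (subst nn_integral_cmult) (auto simp: Gamma_conv_nn_integral_real)
  also have "\<dots> = ennreal 1"
    using assms by (subst ennreal_mult'[symmetric]) auto
  finally show "(\<integral>\<^sup>+ g. ennreal (gamma_density s g) \<partial>lborel) = ennreal 1" .
qed (use assms in \<open>auto simp: gamma_density_nonneg\<close>)

text \<open>Dividing by \<open>g\<close> lowers the shape by one; every negative moment below is
  reduced by this rule. For \<open>g\<close> not positive both densities vanish, so the division
  convention at 0 is harmless.\<close>

lemma gamma_density_divide:
  assumes "s > 0"
  shows "gamma_density (s + 1) g / g = gamma_density s g / s"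
proof (cases "g > 0")
  case True
  have "Gamma (s + 1) = s * Gamma s"
    using assms by (intro Gamma_plus1) (auto elim!: nonpos_Ints_cases')
  moreover have "g powr s = g * g powr (s - 1)"
    using True by (metis powr_mult_base add.commute diff_add_cancel less_imp_le)
  ultimately show ?thesis
    using True assms by (simp add: gamma_density_def max_def)
qed (auto simp: gamma_density_nonpos)

text \<open>The truncation \<open>max 0 g\<close> makes the density 0 on the negative half-line,
  since \<open>0 powr y = 0\<close>; a positive exponent \<open>s - 1\<close> lets the two pieces
  meet at 0 without a jump.\<close>

lemma continuous_on_gamma_density:
  assumes "s > 1"
  shows "continuous_on A (gamma_density s)"
  unfolding gamma_density_def using assms
  by (intro continuous_intros continuous_on_powr') (auto simp: Gamma_eq_zero_iff elim!: nonpos_Ints_cases')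

text \<open>Squaring a distribution function: \<open>2 P p\<close> is the density of the larger of two independent
  copies.\<close>

locale continuous_density =
  fixes p P :: "real \<Rightarrow> real"
  assumes cont: "continuous_on UNIV p" and nonneg: "\<And>g. 0 \<le> p g"
    and nonpos: "\<And>g. g \<le> 0 \<Longrightarrow> p g = 0"
    and total: "has_bochner_integral lborel p 1"
  defines "P \<equiv> (\<lambda>y. LINT g:{..y}|lborel. p g)"
begin

lemma measurable_p [measurable]: "p \<in> borel_measurable borel"
  using cont by (rule borel_measurable_continuous_onI)

lemma set_integrable: "A \<in> sets borel \<Longrightarrow> set_integrable lborel A p"
  using total unfolding set_integrable_def has_bochner_integral_iff
  by (intro integrable_mult_indicator) auto

lemma P_eq_integral:
  assumes "c \<le> 0"
  shows "P y = integral {c..y} p"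
proof -
  have "P y = (LINT g:{c..y}|lborel. p g)"
    unfolding P_def set_lebesgue_integral_def using assms nonpos
    by (intro Bochner_Integration.integral_cong) (auto simp: indicator_def)
  then show ?thesis
    by (simp add: set_borel_integral_eq_integral(2)[OF set_integrable])
qed

lemma DERIV_P: "(P has_real_derivative p y) (at y)"
proof -
  \<comment> \<open>Strictly below both 0 and \<open>y\<close>: no mass lies to the left of
    \<open>c\<close>, and \<open>y\<close> is an interior point of the interval, so the derivative
    is two-sided.\<close>
  define c where "c = min y 0 - 1"
  have "((\<lambda>x. integral {c..x} p) has_real_derivative p y) (at y within {c..y+1})"
    using cont by (intro integral_has_real_derivative) (auto simp: c_def intro: continuous_on_subset)
  moreover have "P = (\<lambda>x. integral {c..x} p)"
    by (intro ext P_eq_integral) (auto simp: c_def)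
  moreover have "at y within {c..y+1} = at y"
    by (rule at_within_interior) (auto simp: c_def)
  ultimately show ?thesis by simp
qed

lemma P_nonneg: "0 \<le> P y"
  unfolding P_def set_lebesgue_integral_def by (intro Bochner_Integration.integral_nonneg) (auto simp: nonneg)

lemma P_le_1: "P y \<le> 1"
proof -
  have "P y \<le> (\<integral>g. p g \<partial>lborel)"
    unfolding P_def set_lebesgue_integral_def
    by (intro integral_mono) 
       (use total set_integrable[of "{..y}"] in \<open>auto simp: set_integrable_def has_bochner_integral_iff indicator_def nonneg\<close>)
  then show ?thesis using total by (simp add: has_bochner_integral_iff)
qed

lemma P_nonpos: "y \<le> 0 \<Longrightarrow> P y = 0"
  unfolding P_def set_lebesgue_integral_def
  by (intro integral_eq_zero_AE) (auto simp: indicator_def nonpos)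

lemma continuous_P: "continuous_on A P"
  using DERIV_P by (meson DERIV_isCont continuous_at_imp_continuous_on)

lemma measurable_P [measurable]: "P \<in> borel_measurable borel"
  using continuous_P by (rule borel_measurable_continuous_onI)

lemma tendsto_P: "(P \<longlongrightarrow> 1) at_top"
  using tendsto_integral_at_top[of lborel p] total
  by (simp add: P_def[abs_def] set_lebesgue_integral_def has_bochner_integral_iff)

lemma integrable_2Pp: "integrable lborel (\<lambda>g. 2 * P g * p g)"
proof (rule Bochner_Integration.integrable_bound)
  show "integrable lborel (\<lambda>g. 2 * p g)"
    using total by (simp add: has_bochner_integral_iff)
  show "AE g in lborel. norm (2 * P g * p g) \<le> norm (2 * p g)"
    using P_le_1 P_nonneg nonneg by (auto simp: abs_mult intro!: mult_left_le_one_le)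
qed measurable

text \<open>\<open>2 P p\<close> is the derivative of the square of \<open>P\<close>, and
  \<open>P\<close> vanishes at the non-positive point \<open>c\<close> from which the integral
  effectively starts.\<close>

lemma set_integral_2Pp: "(LINT g:{..y}|lborel. 2 * P g * p g) = (P y)\<^sup>2"
proof -
  define c where "c = min y 0"
  have "(LINT g:{..y}|lborel. 2 * P g * p g) = (\<integral>g. 2 * P g * p g * indicator {c..y} g \<partial>lborel)"
    unfolding set_lebesgue_integral_def
    by (intro Bochner_Integration.integral_cong) (auto simp: indicator_def c_def nonpos)
  also have "\<dots> = (P y)\<^sup>2 - (P c)\<^sup>2"
  proof (rule integral_FTC_Icc_nonneg)
    show "((\<lambda>y. (P y)\<^sup>2) has_real_derivative 2 * P g * p g) (at g)" for g
      using DERIV_P[of g] by (auto intro!: derivative_eq_intros)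
  qed (auto simp: c_def P_nonneg nonneg)
  finally show ?thesis by (simp add: P_nonpos c_def)
qed

lemma has_bochner_integral_2Pp: "has_bochner_integral lborel (\<lambda>g. 2 * P g * p g) 1"
proof -
  have "((\<lambda>y. (P y)\<^sup>2) \<longlongrightarrow> (\<integral>g. 2 * P g * p g \<partial>lborel)) at_top"
    using tendsto_integral_at_top[OF _ integrable_2Pp]
    by (simp add: set_integral_2Pp[symmetric] set_lebesgue_integral_def)
  moreover have "((\<lambda>y. (P y)\<^sup>2) \<longlongrightarrow> 1\<^sup>2) at_top"
    by (intro tendsto_intros tendsto_P)
  ultimately have "(\<integral>g. 2 * P g * p g \<partial>lborel) = 1"
    using tendsto_unique trivial_limit_at_top_linorder by fastforce
  then show ?thesis using integrable_2Pp by (simp add: has_bochner_integral_iff)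
qed

end

lemma continuous_density_gamma: "s > 1 \<Longrightarrow> continuous_density (gamma_density s)"
  by unfold_locales
     (auto intro: continuous_on_gamma_density gamma_density_nonneg gamma_density_nonpos
        has_bochner_integral_gamma_density)

lemma gamma_cdf_eq: "gamma_cdf s = (\<lambda>y. LINT g:{..y}|lborel. gamma_density s g)"
  by (simp add: gamma_cdf_def[abs_def])

lemmas DERIV_gamma_cdf =
    continuous_density.DERIV_P[OF continuous_density_gamma, folded gamma_cdf_def gamma_cdf_eq]
  and gamma_cdf_nonneg =
    continuous_density.P_nonneg[OF continuous_density_gamma, folded gamma_cdf_def gamma_cdf_eq]
  and gamma_cdf_le_1 =
    continuous_density.P_le_1[OF continuous_density_gamma, folded gamma_cdf_def gamma_cdf_eq]
  and gamma_cdf_nonpos =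
    continuous_density.P_nonpos[OF continuous_density_gamma, folded gamma_cdf_def gamma_cdf_eq]
  and measurable_gamma_cdf =
    continuous_density.measurable_P[OF continuous_density_gamma, folded gamma_cdf_def gamma_cdf_eq]
  and continuous_on_gamma_cdf =
    continuous_density.continuous_P[OF continuous_density_gamma, folded gamma_cdf_def gamma_cdf_eq]
  and set_integral_gamma_max_density =
    continuous_density.set_integral_2Pp[OF continuous_density_gamma, folded gamma_cdf_def gamma_cdf_eq]
  and has_bochner_integral_gamma_max_density =
    continuous_density.has_bochner_integral_2Pp[OF continuous_density_gamma, folded gamma_cdf_def gamma_cdf_eq]

text \<open>Integration by parts in differential form: on the positive half-line
  \<open>gamma_density (s + 1)\<close> has derivative
  \<open>gamma_density s - gamma_density (s + 1)\<close>, so the difference \<open>D\<close> of the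
  two sides is constant, and it is 0 at 0.\<close>

lemma gamma_cdf_recurrence:
  assumes s: "s > 1"
  shows "gamma_cdf s y - gamma_cdf (s + 1) y = gamma_density (s + 1) y"
proof (cases "y > 0")
  case True
  define D where "D = (\<lambda>y. gamma_cdf s y - gamma_cdf (s + 1) y - gamma_density (s + 1) y)"
  have G: "Gamma (s + 1) = s * Gamma s" "Gamma s > 0"
    using s by (auto intro!: Gamma_plus1 elim!: nonpos_Ints_cases')
  have "D y = D 0"
  proof (rule DERIV_isconst_end[where f = D])
    show "continuous_on {0..y} D"
      unfolding D_def using s
      by (intro continuous_intros continuous_on_gamma_cdf continuous_on_gamma_density) auto
    fix z assume z: "0 < z" "z < y"
    have "((\<lambda>g. g powr s * exp (- g) / Gamma (s + 1)) has_real_derivative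
        (s * z powr (s - 1) * exp (- z) - z powr s * exp (- z)) / Gamma (s + 1)) (at z)"
      using z s by (auto intro!: derivative_eq_intros simp: diff_divide_distrib)
    also have "(s * z powr (s - 1) * exp (- z) - z powr s * exp (- z)) / Gamma (s + 1)
        = gamma_density s z - gamma_density (s + 1) z"
      using z s G by (simp add: gamma_density_def diff_divide_distrib)
    finally have *: "((\<lambda>g. g powr s * exp (- g) / Gamma (s + 1)) has_real_derivative
        gamma_density s z - gamma_density (s + 1) z) (at z)" .
    have "(gamma_density (s + 1) has_real_derivative
        gamma_density s z - gamma_density (s + 1) z) (at z)"
      by (rule has_field_derivative_transform_within_open[OF *, where S = "{0<..}"])
         (use z in \<open>auto simp: gamma_density_def max_def\<close>)
    then show "(D has_real_derivative 0) (at z)"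
      unfolding D_def using s
      by (auto intro!: derivative_eq_intros DERIV_gamma_cdf)
  qed (use True in auto)
  then show ?thesis
    using s by (simp add: D_def gamma_cdf_nonpos gamma_density_nonpos)
qed (use s in \<open>simp add: gamma_cdf_nonpos gamma_density_nonpos\<close>)

section \<open>Duplication formula and the ratio of Gamma values half a unit apart\<close>

lemma Gamma_duplication_real:
  fixes z :: real
  assumes "z > 0"
  shows "Gamma z * Gamma (z + 1/2) = 2 powr (1 - 2 * z) * sqrt pi * Gamma (2 * z)"
proof -
  have *: "complex_of_real z \<notin> \<int>\<^sub>\<le>\<^sub>0" "complex_of_real z + 1/2 \<notin> \<int>\<^sub>\<le>\<^sub>0"
    using assms by (auto elim!: nonpos_Ints_cases' simp: complex_eq_iff)
  have h: "complex_of_real z + 1/2 = of_real (z + 1/2)" "2 * complex_of_real z = of_real (2 * z)"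
    by simp_all
  have "complex_of_real (Gamma z * Gamma (z + 1/2)) =
      of_real (exp ((1 - 2 * z) * ln 2) * sqrt pi * Gamma (2 * z))"
    using Gamma_legendre_duplication[OF *] unfolding h Gamma_complex_of_real
    by (simp add: exp_of_real[symmetric])
  then show ?thesis
    unfolding of_real_eq_iff by (simp add: powr_def)
qed

text \<open>The product is proportional to \<open>g powr (2 * s - 1) * exp (- 2 * g)\<close>, the
  density of shape \<open>2 * s\<close> at \<open>2 * g\<close>. The constant \<open>c\<close>
  compares the normalisations, rescaling contributes the factor 1/2, and the duplication formula
  removes \<open>Gamma (2 * s)\<close>.\<close>

lemma has_bochner_integral_gamma_density_product:
  assumes "s > 1"
  shows "has_bochner_integral lborel (\<lambda>g. gamma_density s g * gamma_density (s + 1) g)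
    (Gamma (s + 1/2) / (2 * sqrt pi * Gamma (s + 1)))"
proof -
  have G: "Gamma s > 0" "Gamma (s + 1) > 0" "Gamma (2 * s) > 0" using assms by auto
  define c where "c = 2 powr (1 - 2 * s) * Gamma (2 * s) / (Gamma s * Gamma (s + 1))"
  have "has_bochner_integral lborel (gamma_density (2 * s)) 1"
    using assms by (intro has_bochner_integral_gamma_density) auto
  then have "has_bochner_integral lborel (\<lambda>g. gamma_density (2 * s) (0 + 2 * g)) (1 /\<^sub>R \<bar>2\<bar>)"
    by (subst (asm) lborel_has_bochner_integral_real_affine_iff[of 2 _ _ 0]) auto
  then have "has_bochner_integral lborel (\<lambda>g. c * gamma_density (2 * s) (0 + 2 * g)) (c * (1 /\<^sub>R \<bar>2\<bar>))"
    by (rule has_bochner_integral_mult_right)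
  moreover have "c * gamma_density (2 * s) (0 + 2 * g) = gamma_density s g * gamma_density (s + 1) g" for g
  proof (cases "g > 0")
    case True
    have "(2 * g) powr (2 * s - 1) = 2 powr (2 * s - 1) * (g powr (s - 1) * g powr s)"
      using True by (simp add: powr_mult powr_add[symmetric])
    moreover have "2 powr (1 - 2 * s) * 2 powr (2 * s - 1) = (1 :: real)"
      by (simp add: powr_add[symmetric])
    moreover have "exp (- (2 * g)) = exp (- g) * exp (- g)"
      by (simp add: exp_add[symmetric])
    ultimately show ?thesis
      using True G by (simp add: c_def gamma_density_def field_simps)
  qed (simp add: gamma_density_nonpos)
  moreover have "c * (1 /\<^sub>R \<bar>2\<bar>) = Gamma (s + 1/2) / (2 * sqrt pi * Gamma (s + 1))"
  proof -
    have "2 powr (1 - 2 * s) * Gamma (2 * s) = Gamma s * Gamma (s + 1/2) / sqrt pi"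
      using Gamma_duplication_real[of s] assms by (simp add: divide_simps mult.commute mult.left_commute)
    then show ?thesis
      using G unfolding c_def by (simp add: divide_simps) (simp add: algebra_simps)
  qed
  ultimately show ?thesis by (simp only:)
qed

lemma Gamma_sq_le:
  fixes y z :: real
  assumes "y > 0" "z > 0"
  shows "(Gamma ((y + z) / 2))\<^sup>2 \<le> Gamma y * Gamma z"
proof -
  have "ln (Gamma ((1 - 1/2) *\<^sub>R y + (1/2) *\<^sub>R z)) \<le> (1 - 1/2) * ln (Gamma y) + (1/2) * ln (Gamma z)"
    using convex_onD[OF log_convex_Gamma_real, of "1/2" y z] assms by simp
  then have "2 * ln (Gamma ((y + z) / 2)) \<le> ln (Gamma y) + ln (Gamma z)"
    by (simp add: field_simps)
  then have "ln ((Gamma ((y + z) / 2))\<^sup>2) \<le> ln (Gamma y * Gamma z)"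
    using assms by (simp add: ln_mult ln_realpow)
  then show ?thesis
    using assms by (subst (asm) ln_le_cancel_iff) auto
qed

text \<open>Two midpoint inequalities from log-convexity: \<open>a + 1/2\<close> lies halfway
  between \<open>a\<close> and \<open>a + 1\<close>, which gives the upper bound, and
  \<open>a + 1\<close> halfway between \<open>a + 1/2\<close> and \<open>a + 3/2\<close>, which
  gives the lower one.\<close>

lemma Gamma_half_ratio_bounds:
  assumes "a > 0"
  shows "Gamma (a + 1/2) / Gamma (a + 1) \<le> 1 / sqrt a"
    and "1 / sqrt (a + 1/2) \<le> Gamma (a + 1/2) / Gamma (a + 1)"
proof -
  have G: "Gamma (a + 1) = a * Gamma a" "Gamma (a + 1/2 + 1) = (a + 1/2) * Gamma (a + 1/2)"
    "Gamma a > 0" "Gamma (a + 1/2) > 0" "Gamma (a + 1) > 0"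
    using assms Gamma_plus1[of a] Gamma_plus1[of "a + 1/2"]
    by (force elim!: nonpos_Ints_cases')+
  have "(Gamma ((a + (a + 1)) / 2))\<^sup>2 \<le> Gamma a * Gamma (a + 1)"
    using assms by (intro Gamma_sq_le) auto
  also have "\<dots> = (Gamma (a + 1))\<^sup>2 / a"
    using G assms by (simp add: power2_eq_square)
  finally have "(Gamma (a + 1/2))\<^sup>2 \<le> (Gamma (a + 1))\<^sup>2 / a"
    by (simp add: add_divide_distrib)
  then have "(Gamma (a + 1/2))\<^sup>2 / (Gamma (a + 1))\<^sup>2 \<le> 1 / a"
    using zero_less_power[OF G(5), of 2] by (subst pos_divide_le_eq) simp_all
  then have "(Gamma (a + 1/2) / Gamma (a + 1))\<^sup>2 \<le> (1 / sqrt a)\<^sup>2"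
    using assms by (simp add: power_divide)
  then show "Gamma (a + 1/2) / Gamma (a + 1) \<le> 1 / sqrt a"
    by (rule power2_le_imp_le) (use assms in auto)
  have "(Gamma ((a + 1/2 + (a + 1/2 + 1)) / 2))\<^sup>2 \<le> Gamma (a + 1/2) * Gamma (a + 1/2 + 1)"
    using assms by (intro Gamma_sq_le) auto
  also have "(a + 1/2 + (a + 1/2 + 1)) / 2 = a + 1" by (simp add: field_simps)
  also have "Gamma (a + 1/2) * Gamma (a + 1/2 + 1) = (a + 1/2) * (Gamma (a + 1/2))\<^sup>2"
    unfolding G(2) by (simp add: power2_eq_square)
  finally have "1 / (a + 1/2) \<le> (Gamma (a + 1/2))\<^sup>2 / (Gamma (a + 1))\<^sup>2"
    using assms zero_less_power[OF G(5), of 2]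
    by (simp only: le_divide_eq) (simp add: divide_simps mult.commute)
  then have "(1 / sqrt (a + 1/2))\<^sup>2 \<le> (Gamma (a + 1/2) / Gamma (a + 1))\<^sup>2"
    using assms by (simp add: power_divide)
  then show "1 / sqrt (a + 1/2) \<le> Gamma (a + 1/2) / Gamma (a + 1)"
    by (rule power2_le_imp_le) (use G in auto)
qed

text \<open>The two bounds on the ratio differ by at most \<open>1 / a\<close>, because the square
  roots involved differ by at most 1. With \<open>a = 1 / b\<close> the error is at most
  \<open>b\<close>, which the O-term of the theorem absorbs.\<close>

lemma Gamma_half_ratio_approx:
  assumes "a > 0"
  shows "\<bar>Gamma (a + 1/2) / Gamma (a + 1) - 1 / sqrt a\<bar> \<le> 1 / a"
proof -
  have "sqrt (a + 1/2) \<le> sqrt a + 1"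
    by (rule real_le_lsqrt) (use assms in \<open>auto simp: power2_sum\<close>)
  then have "1 / sqrt a - 1 / sqrt (a + 1/2) \<le> 1 / (sqrt a * sqrt (a + 1/2))"
    using assms by (simp add: divide_simps)
  also have "\<dots> \<le> 1 / (sqrt a * sqrt a)"
    using assms by (intro divide_left_mono mult_left_mono) auto
  finally show ?thesis
    using Gamma_half_ratio_bounds[OF assms] assms by simp
qed

section \<open>Moments of the inverse Gamma distribution\<close>

text \<open>One factor \<open>c / g\<close> is traded for one unit of shape. The fourth moment at
  shape \<open>a + 1\<close> thus ends at shape \<open>a - 3\<close>, which is where the later
  condition \<open>a > 3\<close> comes from.\<close>

lemma has_bochner_integral_gamma_inverse_moment_Suc:
  assumes "s > 0"
    and "has_bochner_integral lborel (\<lambda>g. gamma_density s g * (c / g) ^ k) m"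
  shows "has_bochner_integral lborel (\<lambda>g. gamma_density (s + 1) g * (c / g) ^ Suc k) (c / s * m)"
proof -
  have "gamma_density (s + 1) g * (c / g) ^ Suc k = c / s * (gamma_density s g * (c / g) ^ k)" for g
  proof -
    have "gamma_density (s + 1) g * (c / g) ^ Suc k = c * (gamma_density (s + 1) g / g) * (c / g) ^ k"
      by simp
    then show ?thesis
      unfolding gamma_density_divide[OF assms(1)] by simp
  qed
  then show ?thesis
    using has_bochner_integral_mult_right[OF assms(2), of "c / s"] by simp
qed

lemma gamma_inverse_moments:
  assumes a: "a > 3" and c: "c = a * x"
  shows "has_bochner_integral lborel (\<lambda>g. gamma_density (a + 1) g * (c / g)) x"
    and "has_bochner_integral lborel (\<lambda>g. gamma_density (a + 1) g * (c / g - x)\<^sup>2) (x\<^sup>2 / (a - 1))"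
    and "has_bochner_integral lborel (\<lambda>g. gamma_density (a + 1) g * (c / g - x) ^ 4)
      (x ^ 4 * (3 * a + 18) / ((a - 1) * (a - 2) * (a - 3)))"
proof -
  note suc = has_bochner_integral_gamma_inverse_moment_Suc
  have m0: "has_bochner_integral lborel (\<lambda>g. gamma_density s g * (c / g) ^ 0) 1" if "s > 0" for s
    using has_bochner_integral_gamma_density[OF that] by simp
  have m1: "has_bochner_integral lborel (\<lambda>g. gamma_density (s + 1) g * (c / g) ^ 1) (c / s)"
    if "s > 0" for s
    using suc[OF that m0[OF that]] by simp
  have m2: "has_bochner_integral lborel (\<lambda>g. gamma_density (s + 1) g * (c / g) ^ 2) (c / s * (c / (s - 1)))"
    if "s > 1" for s
    using suc[of s c 1 "c / (s - 1)"] m1[of "s - 1"] that by (simp add: numeral_2_eq_2)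
  have m3: "has_bochner_integral lborel (\<lambda>g. gamma_density (s + 1) g * (c / g) ^ 3)
      (c / s * (c / (s - 1) * (c / (s - 2))))" if "s > 2" for s
    using suc[of s c 2 "c / (s - 1) * (c / (s - 2))"] m2[of "s - 1"] that by (simp add: numeral_3_eq_3)
  have m4: "has_bochner_integral lborel (\<lambda>g. gamma_density (s + 1) g * (c / g) ^ 4)
      (c / s * (c / (s - 1) * (c / (s - 2) * (c / (s - 3)))))" if "s > 3" for s
    using suc[of s c 3 "c / (s - 1) * (c / (s - 2) * (c / (s - 3)))"] m3[of "s - 1"] that by (simp add: eval_nat_numeral)
  note ms = m0[of "a + 1"] m1[of a] m2[of a] m3[of a] m4[of a]
  show "has_bochner_integral lborel (\<lambda>g. gamma_density (a + 1) g * (c / g)) x"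
    using ms(2) a by (simp add: c)
  have "has_bochner_integral lborel
      (\<lambda>g. gamma_density (a + 1) g * (c / g) ^ 2 + (- 2 * x) * (gamma_density (a + 1) g * (c / g) ^ 1)
          + x\<^sup>2 * (gamma_density (a + 1) g * (c / g) ^ 0))
      (c / a * (c / (a - 1)) + (- 2 * x) * (c / a) + x\<^sup>2 * 1)"
    using a by (intro has_bochner_integral_add has_bochner_integral_mult_right ms) auto
  moreover have "gamma_density (a + 1) g * (c / g) ^ 2 + (- 2 * x) * (gamma_density (a + 1) g * (c / g) ^ 1)
          + x\<^sup>2 * (gamma_density (a + 1) g * (c / g) ^ 0) = gamma_density (a + 1) g * (c / g - x)\<^sup>2" for g
    by (simp add: power2_eq_square algebra_simps)
  moreover have "c / a * (c / (a - 1)) + (- 2 * x) * (c / a) + x\<^sup>2 * 1 = x\<^sup>2 / (a - 1)"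
    using a by (simp add: c divide_simps) (simp add: power2_eq_square algebra_simps)
  ultimately show "has_bochner_integral lborel (\<lambda>g. gamma_density (a + 1) g * (c / g - x)\<^sup>2) (x\<^sup>2 / (a - 1))"
    by (simp only:)
  have "has_bochner_integral lborel
      (\<lambda>g. gamma_density (a + 1) g * (c / g) ^ 4 + (- 4 * x) * (gamma_density (a + 1) g * (c / g) ^ 3)
          + (6 * x\<^sup>2) * (gamma_density (a + 1) g * (c / g) ^ 2)
          + (- 4 * x ^ 3) * (gamma_density (a + 1) g * (c / g) ^ 1)
          + x ^ 4 * (gamma_density (a + 1) g * (c / g) ^ 0))
      (c / a * (c / (a - 1) * (c / (a - 2) * (c / (a - 3)))) + (- 4 * x) * (c / a * (c / (a - 1) * (c / (a - 2))))
        + (6 * x\<^sup>2) * (c / a * (c / (a - 1))) + (- 4 * x ^ 3) * (c / a) + x ^ 4 * 1)"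
    using a by (intro has_bochner_integral_add has_bochner_integral_mult_right ms) auto
  moreover have "gamma_density (a + 1) g * (c / g) ^ 4 + (- 4 * x) * (gamma_density (a + 1) g * (c / g) ^ 3)
          + (6 * x\<^sup>2) * (gamma_density (a + 1) g * (c / g) ^ 2)
          + (- 4 * x ^ 3) * (gamma_density (a + 1) g * (c / g) ^ 1)
          + x ^ 4 * (gamma_density (a + 1) g * (c / g) ^ 0) = gamma_density (a + 1) g * (c / g - x) ^ 4" for g
    unfolding power4_eq_xxxx power3_eq_cube power2_eq_square by algebra
  moreover have "c / a * (c / (a - 1) * (c / (a - 2) * (c / (a - 3)))) + (- 4 * x) * (c / a * (c / (a - 1) * (c / (a - 2))))
        + (6 * x\<^sup>2) * (c / a * (c / (a - 1))) + (- 4 * x ^ 3) * (c / a) + x ^ 4 * 1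
      = x ^ 4 * (3 * a + 18) / ((a - 1) * (a - 2) * (a - 3))"
  proof -
    have "c / a = x" "c / (a - 1) = x * (a / (a - 1))" "c / (a - 2) = x * (a / (a - 2))"
      "c / (a - 3) = x * (a / (a - 3))" using a by (simp_all add: c)
    \<comment> \<open>The -3 collects the last two binomial terms, as \<open>c / a = x\<close>. Over
      the common denominator the cubic and quadratic terms of the numerator cancel, so the fourth
      central moment has order \<open>1 / a\<^sup>2\<close>.\<close>
    moreover have "a / (a - 1) * (a / (a - 2)) * (a / (a - 3)) - 4 * (a / (a - 1) * (a / (a - 2)))
        + 6 * (a / (a - 1)) - 3 = (3 * a + 18) / ((a - 1) * (a - 2) * (a - 3))"
      using a by (simp add: divide_simps) algebra
    ultimately show ?thesis
      unfolding times_divide_eq_right[symmetric] by (simp only: flip: \<open>_ = (3 * a + 18) / _\<close>)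
        (simp add: power4_eq_xxxx power3_eq_cube power2_eq_square algebra_simps)
  qed
  ultimately show "has_bochner_integral lborel (\<lambda>g. gamma_density (a + 1) g * (c / g - x) ^ 4)
      (x ^ 4 * (3 * a + 18) / ((a - 1) * (a - 2) * (a - 3)))"
    by (simp only:)
qed

text \<open>The mean of the smaller of two independent inverse Gamma variables; the recurrence for the
  distribution function reduces it to the integral of a product of two Gamma densities.\<close>

lemma gamma_inverse_min_moment:
  assumes a: "a > 1" and c: "c = a * x"
  shows "has_bochner_integral lborel
    (\<lambda>g. 2 * gamma_cdf (a + 1) g * gamma_density (a + 1) g * (c / g))
    (x - x / sqrt pi * (Gamma (a + 1/2) / Gamma (a + 1)))"
proof -
  have "has_bochner_integral lborel
      (\<lambda>g. x * (2 * gamma_cdf a g * gamma_density a g)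
         - 2 * x * (gamma_density a g * gamma_density (a + 1) g))
      (x * 1 - 2 * x * (Gamma (a + 1/2) / (2 * sqrt pi * Gamma (a + 1))))"
    using a by (intro has_bochner_integral_diff has_bochner_integral_mult_right
        has_bochner_integral_gamma_max_density has_bochner_integral_gamma_density_product)
  moreover have "x * (2 * gamma_cdf a g * gamma_density a g)
         - 2 * x * (gamma_density a g * gamma_density (a + 1) g)
      = 2 * gamma_cdf (a + 1) g * gamma_density (a + 1) g * (c / g)" for g
  proof -
    have "gamma_density (a + 1) g * (c / g) = c * (gamma_density (a + 1) g / g)"
      by simp
    \<comment> \<open>The choice \<open>c = a * x\<close> cancels the factor \<open>1 / a\<close>
      left by lowering the shape. The density now has shape \<open>a\<close> while the distribution
      function still has shape \<open>a + 1\<close>; the recurrence repairs this mismatch.\<close>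
    also have "\<dots> = x * gamma_density a g"
      using a by (subst gamma_density_divide) (auto simp: c)
    finally have *: "2 * gamma_cdf (a + 1) g * gamma_density (a + 1) g * (c / g)
        = 2 * gamma_cdf (a + 1) g * (x * gamma_density a g)"
      by (simp only: mult.assoc)
    show ?thesis
      unfolding *
      unfolding gamma_cdf_recurrence[OF a, of g, symmetric] by (simp add: algebra_simps)
  qed
  moreover have "x * 1 - 2 * x * (Gamma (a + 1/2) / (2 * sqrt pi * Gamma (a + 1)))
      = x - x / sqrt pi * (Gamma (a + 1/2) / Gamma (a + 1))"
    by simp
  ultimately show ?thesis by (simp only:)
qed

section \<open>The kernel as a survival function\<close>

text \<open>Fubini: both sides integrate \<open>w g\<close> over the pairs with
  \<open>t \<le> c / g\<close>, one slicing by \<open>t\<close> and the other by \<open>g\<close>.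
  Used once with \<open>w\<close> the Gamma density and once with the density of a maximum.\<close>

lemma integral_scaled_inverse_survival:
  fixes w :: "real \<Rightarrow> real"
  assumes \<mu>: "real_distribution \<mu>"
    and w: "integrable lborel w" "\<And>g. 0 \<le> w g" "\<And>g. g \<le> 0 \<Longrightarrow> w g = 0" and c: "c > 0"
  shows "(\<integral>t. (if t > 0 then LINT g:{..c / t}|lborel. w g else LINT g|lborel. w g) \<partial>\<mu>)
    = (\<integral>g. w g * cdf \<mu> (c / g) \<partial>lborel)"
proof -
  interpret real_distribution \<mu> by fact
  interpret pair_sigma_finite lborel \<mu> ..
  have [measurable]: "w \<in> borel_measurable borel"
    using borel_measurable_integrable[OF w(1)] by simp
  have [measurable]: "cdf \<mu> \<in> borel_measurable borel"
    by (intro borel_measurable_mono monoI cdf_nondecreasing)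
  define f where "f = (\<lambda>g t. w g * indicator {..c / g} t)"
  have [measurable]: "case_prod f \<in> borel_measurable (lborel \<Otimes>\<^sub>M \<mu>)"
    unfolding f_def indicator_def atMost_iff by measurable
  have f2: "(\<integral>t. f g t \<partial>\<mu>) = w g * cdf \<mu> (c / g)" for g
    by (simp add: f_def cdf_def)
  have int: "integrable (lborel \<Otimes>\<^sub>M \<mu>) (case_prod f)"
  proof (rule Fubini_integrable)
    have "integrable lborel (\<lambda>g. w g * cdf \<mu> (c / g))"
    proof (rule Bochner_Integration.integrable_bound[OF w(1)])
      show "AE g in lborel. norm (w g * cdf \<mu> (c / g)) \<le> norm (w g)"
        by (auto simp: abs_mult cdf_nonneg intro!: mult_left_le cdf_bounded_prob)
    qed measurable
    then show "integrable lborel (\<lambda>g. \<integral>t. norm (case (g, t) of (g, t) \<Rightarrow> f g t) \<partial>\<mu>)"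
      using w(2) by (simp add: f_def abs_mult cdf_def)
    show "AE g in lborel. integrable \<mu> (\<lambda>t. case (g, t) of (g, t) \<Rightarrow> f g t)"
      by (auto simp: f_def intro!: AE_I2 integrable_mult_right integrable_const_bound[where B = 1])
  qed measurable
  have "(\<integral>g. f g t \<partial>lborel) = (if t > 0 then LINT g:{..c / t}|lborel. w g else LINT g|lborel. w g)" for t
  proof -
    have "f g t = (if t > 0 then indicator {..c / t} g *\<^sub>R w g else w g)" for g
    \<comment> \<open>For positive \<open>g\<close> the condition \<open>t \<le> c / g\<close> means
      \<open>g \<le> c / t\<close> when \<open>t\<close> is positive and holds always otherwise,
      hence the total mass in that branch. For other \<open>g\<close> the weight is 0.\<close>
    proof (cases "g > 0")
      case True
      then show ?thesis
        using c mult_nonneg_nonpos[of g t]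
        by (auto simp: f_def indicator_def divide_simps mult.commute not_less)
    qed (auto simp: f_def w(3))
    then show ?thesis by (simp add: set_lebesgue_integral_def)
  qed
  then show ?thesis
    using Fubini_integral[OF int] f2 by simp
qed

lemma upper_Gamma_eq:
  assumes "s > 0" "z > 0"
  shows "upper_Gamma s z / Gamma s = 1 - gamma_cdf s z"
proof -
  have p: "integrable lborel (gamma_density s)" "(LINT g|lborel. gamma_density s g) = 1"
    using has_bochner_integral_gamma_density[OF assms(1)] by (auto simp: has_bochner_integral_iff)
  have "1 = (\<integral>g. indicator {..z} g * gamma_density s g + indicator {z..} g * gamma_density s g \<partial>lborel)"
    unfolding p(2)[symmetric]
  proof (rule integral_cong_AE)
    \<comment> \<open>The two half-lines overlap in \<open>z\<close>, a null set.\<close>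
    show "AE g in lborel. gamma_density s g
        = indicator {..z} g * gamma_density s g + indicator {z..} g * gamma_density s g"
      using AE_lborel_singleton[of z] by eventually_elim (auto simp: indicator_def)
  qed measurable
  also have "\<dots> = gamma_cdf s z + (\<integral>g. indicator {z..} g * gamma_density s g \<partial>lborel)"
    unfolding gamma_cdf_def set_lebesgue_integral_def
    by (subst Bochner_Integration.integral_add) (auto intro!: integrable_real_mult_indicator p simp: mult.commute)
  also have "(\<integral>g. indicator {z..} g * gamma_density s g \<partial>lborel) = upper_Gamma s z / Gamma s"
    unfolding upper_Gamma_def set_lebesgue_integral_def integral_divide_zero[symmetric]
    using assms
    by (intro Bochner_Integration.integral_cong) (auto simp: gamma_density_def indicator_def)
  finally show ?thesis by simp
qed

lemma IGam_survival_eq: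
  assumes "b > 0" "x > 0"
  shows "IGam_survival (1 / b + 1) (b / x) t =
    (if t > 0 then gamma_cdf (1 / b + 1) (x / b / t) else 1)"
  using assms upper_Gamma_eq[of "1 / b + 1" "x / b / t"]
  by (auto simp: IGam_survival_def mult.commute Gamma_real_neq_0 add_pos_pos)

lemma IGam_survival_measurable [measurable]:
  assumes "b > 0" "x > 0"
  shows "IGam_survival (1 / b + 1) (b / x) \<in> borel_measurable borel"
proof -
  have [measurable]: "gamma_cdf (1 / b + 1) \<in> borel_measurable borel"
    using assms by (intro measurable_gamma_cdf) auto
  have "(\<lambda>t. if t > 0 then gamma_cdf (1 / b + 1) (x / b / t) else 1) \<in> borel_measurable borel"
    by measurable
  then show ?thesis
    using IGam_survival_eq[OF assms] by presburger
qed

lemma IGam_survival_bounds: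
  assumes "b > 0" "x > 0"
  shows "0 \<le> IGam_survival (1 / b + 1) (b / x) t" "IGam_survival (1 / b + 1) (b / x) t \<le> 1"
  using assms by (auto simp: IGam_survival_eq gamma_cdf_nonneg gamma_cdf_le_1)

text \<open>For an observation independent of \<open>T\<close>, the event that it does not exceed
  \<open>T\<close> has the same probability whichever variable is integrated out first. In the
  second part the squared Gamma distribution function is that of the larger of two copies.\<close>

lemma expectation_IGam_survival:
  assumes \<mu>: "real_distribution \<mu>" and "b > 0" "x > 0"
  shows "(\<integral>t. IGam_survival (1 / b + 1) (b / x) t \<partial>\<mu>)
      = (\<integral>g. gamma_density (1 / b + 1) g * cdf \<mu> (x / b / g) \<partial>lborel)"
    and "(\<integral>t. (IGam_survival (1 / b + 1) (b / x) t)\<^sup>2 \<partial>\<mu>)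
      = (\<integral>g. 2 * gamma_cdf (1 / b + 1) g * gamma_density (1 / b + 1) g * cdf \<mu> (x / b / g) \<partial>lborel)"
proof -
  define s where "s = 1 / b + 1"
  have s: "s > 1" using assms by (simp add: s_def)
  then have "s > 0" by simp
  note p = gamma_density_nonneg[OF this] has_bochner_integral_gamma_density[OF this]
    gamma_density_nonpos[of _ s]
  note P = gamma_cdf_nonneg[OF s] has_bochner_integral_gamma_max_density[OF s]
  have c: "x / b > 0" using assms by simp
  show "(\<integral>t. IGam_survival (1 / b + 1) (b / x) t \<partial>\<mu>)
      = (\<integral>g. gamma_density (1 / b + 1) g * cdf \<mu> (x / b / g) \<partial>lborel)"
  proof -
    have "(\<integral>t. (if t > 0 then LINT g:{..x / b / t}|lborel. gamma_density s g
        else LINT g|lborel. gamma_density s g) \<partial>\<mu>)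
      = (\<integral>g. gamma_density s g * cdf \<mu> (x / b / g) \<partial>lborel)"
      using p s by (intro integral_scaled_inverse_survival[OF \<mu> _ _ _ c])
         (auto simp: has_bochner_integral_iff)
    moreover have "(if t > 0 then LINT g:{..x / b / t}|lborel. gamma_density s g
        else LINT g|lborel. gamma_density s g) = IGam_survival s (b / x) t" for t
      using p s IGam_survival_eq[OF assms(2,3), of t]
      by (auto simp: has_bochner_integral_iff s_def gamma_cdf_def)
    ultimately show ?thesis
      by (simp only: flip: s_def)
  qed
  have "(\<integral>t. (if t > 0 then LINT g:{..x / b / t}|lborel. 2 * gamma_cdf s g * gamma_density s g
      else LINT g|lborel. 2 * gamma_cdf s g * gamma_density s g) \<partial>\<mu>)
    = (\<integral>g. 2 * gamma_cdf s g * gamma_density s g * cdf \<mu> (x / b / g) \<partial>lborel)"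
    using P s by (intro integral_scaled_inverse_survival[OF \<mu> _ _ _ c])
       (auto simp: has_bochner_integral_iff p P)
  moreover have "(if t > 0 then LINT g:{..x / b / t}|lborel. 2 * gamma_cdf s g * gamma_density s g
      else LINT g|lborel. 2 * gamma_cdf s g * gamma_density s g)
      = (IGam_survival s (b / x) t)\<^sup>2" for t
    using P(2) set_integral_gamma_max_density[OF s] IGam_survival_eq[OF assms(2,3), of t] by (auto simp: has_bochner_integral_iff s_def)
  ultimately show "(\<integral>t. (IGam_survival (1 / b + 1) (b / x) t)\<^sup>2 \<partial>\<mu>)
      = (\<integral>g. 2 * gamma_cdf (1 / b + 1) g * gamma_density (1 / b + 1) g * cdf \<mu> (x / b / g) \<partial>lborel)"
    by (simp only: flip: s_def)
qed

section \<open>Bias and variance of the estimator\<close>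

lemma (in prob_space) integrable_bounded_powers:
  fixes Y :: "'a \<Rightarrow> real"
  assumes [measurable]: "random_variable borel Y" and B: "\<And>\<omega>. \<bar>Y \<omega>\<bar> \<le> B"
  shows "integrable M (\<lambda>\<omega>. Y \<omega> ^ k)"
proof (rule integrable_const_bound[where B = "B ^ k"])
  show "AE \<omega> in M. norm (Y \<omega> ^ k) \<le> B ^ k"
    using B by (auto simp: power_abs intro!: power_mono)
qed measurable

lemma (in prob_space) MSE_eq_variance_Bias:
  fixes Y :: "'a \<Rightarrow> real"
  assumes "random_variable borel Y" "\<And>\<omega>. \<bar>Y \<omega>\<bar> \<le> B"
  shows "MSE M Y \<theta> = variance Y + (Bias M Y \<theta>)\<^sup>2"
proof -
  have int: "integrable M Y" "integrable M (\<lambda>\<omega>. (Y \<omega>)\<^sup>2)"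
    using integrable_bounded_powers[OF assms, of 1] integrable_bounded_powers[OF assms, of 2] by simp_all
  have "MSE M Y \<theta> = expectation (\<lambda>\<omega>. (Y \<omega>)\<^sup>2 - 2 * \<theta> * Y \<omega> + \<theta>\<^sup>2)"
    unfolding MSE_def by (simp add: power2_diff algebra_simps)
  also have "\<dots> = expectation (\<lambda>\<omega>. (Y \<omega>)\<^sup>2) - 2 * \<theta> * expectation Y + \<theta>\<^sup>2"
    using int by (simp add: prob_space)
  finally show ?thesis
    unfolding variance_eq[OF int] by (simp add: Bias_def power2_diff)
qed

lemma (in prob_space) variance_sum_indep:
  fixes Y :: "'i \<Rightarrow> 'a \<Rightarrow> real"
  assumes ind: "indep_vars (\<lambda>_. borel) Y I" and I: "finite I"
    and B: "\<And>i \<omega>. i \<in> I \<Longrightarrow> \<bar>Y i \<omega>\<bar> \<le> B"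
  shows "variance (\<lambda>\<omega>. \<Sum>i\<in>I. Y i \<omega>) = (\<Sum>i\<in>I. variance (Y i))"
proof -
  have rv [measurable]: "random_variable borel (Y i)" if "i \<in> I" for i
    using ind that unfolding indep_vars_def2 by auto
  have int: "integrable M (Y i)" if "i \<in> I" for i
    using integrable_bounded_powers[OF rv[OF that] B[OF that], of 1] by simp
  \<comment> \<open>After centring, independence makes the mixed products integrate to 0, so only
    the diagonal of the double sum survives.\<close>
  define Z where "Z = (\<lambda>i \<omega>. Y i \<omega> - expectation (Y i))"
  have indZ: "indep_vars (\<lambda>_. borel) Z I"
    unfolding Z_def by (rule indep_vars_compose2[OF ind]) auto
  have rvZ [measurable]: "random_variable borel (Z i)" if "i \<in> I" for i
    using indZ that unfolding indep_vars_def2 by auto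
  have EZ: "expectation (Z i) = 0" if "i \<in> I" for i
    using int[OF that] by (simp add: Z_def prob_space)
  have BZ: "\<bar>Z i \<omega>\<bar> \<le> B + B" if "i \<in> I" for i \<omega>
  proof -
    have "\<bar>expectation (Y i)\<bar> \<le> B"
      using int[OF that] B[OF that]
      by (intro order_trans[OF integral_abs_bound] integral_le_const) auto
    then show ?thesis
      using B[OF that, of \<omega>] by (simp add: Z_def)
  qed
  have intZZ: "integrable M (\<lambda>\<omega>. Z i \<omega> * Z j \<omega>)" if "i \<in> I" "j \<in> I" for i j
  proof (rule integrable_const_bound[where B = "(B + B) * (B + B)"])
    show "AE \<omega> in M. norm (Z i \<omega> * Z j \<omega>) \<le> (B + B) * (B + B)"
    proof (rule AE_I2)
      fix \<omega>
      have "\<bar>Z i \<omega>\<bar> * \<bar>Z j \<omega>\<bar> \<le> (B + B) * (B + B)"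
        using BZ[OF that(1), of \<omega>] BZ[OF that(2), of \<omega>] by (intro mult_mono) auto
      then show "norm (Z i \<omega> * Z j \<omega>) \<le> (B + B) * (B + B)"
        by (simp add: abs_mult)
    qed
  qed (use that in measurable)
  have EZZ: "expectation (\<lambda>\<omega>. Z i \<omega> * Z j \<omega>) = 0" if "i \<in> I" "j \<in> I" "i \<noteq> j" for i j
  proof -
    have "expectation (\<lambda>\<omega>. \<Prod>k\<in>{i, j}. Z k \<omega>) = (\<Prod>k\<in>{i, j}. expectation (Z k))"
    proof (rule indep_vars_lebesgue_integral)
      show "indep_vars (\<lambda>_. borel) Z {i, j}"
        using indZ by (rule indep_vars_subset) (use that in auto)
      show "integrable M (Z k)" if "k \<in> {i, j}" for k
        using that \<open>i \<in> I\<close> \<open>j \<in> I\<close> int by (auto simp: Z_def)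
    qed auto
    then show ?thesis using that EZ by simp
  qed
  have "variance (\<lambda>\<omega>. \<Sum>i\<in>I. Y i \<omega>) = expectation (\<lambda>\<omega>. (\<Sum>i\<in>I. Z i \<omega>)\<^sup>2)"
    using int by (simp add: Z_def sum_subtractf)
  also have "\<dots> = expectation (\<lambda>\<omega>. \<Sum>i\<in>I. \<Sum>j\<in>I. Z i \<omega> * Z j \<omega>)"
    by (simp add: power2_eq_square sum_product)
  also have "\<dots> = (\<Sum>i\<in>I. \<Sum>j\<in>I. expectation (\<lambda>\<omega>. Z i \<omega> * Z j \<omega>))"
    using intZZ by (subst Bochner_Integration.integral_sum) (auto intro!: sum.cong Bochner_Integration.integral_sum)
  also have "\<dots> = (\<Sum>i\<in>I. \<Sum>j\<in>I. if i = j then variance (Y i) else 0)"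
    using EZZ by (intro sum.cong refl) (auto simp: Z_def power2_eq_square)
  also have "\<dots> = (\<Sum>i\<in>I. variance (Y i))"
    using I by (simp add: sum.delta')
  finally show ?thesis .
qed

lemma (in prob_space) IGam_cdf_estimator_moments:
  assumes ind: "indep_vars (\<lambda>_. borel) X {1..}"
    and cdf: "\<forall>i\<ge>1. cdf (distr M borel (X i)) = F"
    and pos: "b > 0" "x > 0" "n \<ge> (1 :: nat)"
  defines "K \<equiv> IGam_survival (1 / b + 1) (b / x)" and "\<mu> \<equiv> distr M borel (X 1)"
  shows "MSE M (IGam_cdf_estimator X n b x) \<theta>
      = variance (IGam_cdf_estimator X n b x) + (Bias M (IGam_cdf_estimator X n b x) \<theta>)\<^sup>2"
    and "Bias M (IGam_cdf_estimator X n b x) \<theta> = (\<integral>t. K t \<partial>\<mu>) - \<theta>"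
    and "variance (IGam_cdf_estimator X n b x)
      = 1 / real n * ((\<integral>t. (K t)\<^sup>2 \<partial>\<mu>) - (\<integral>t. K t \<partial>\<mu>)\<^sup>2)"
proof -
  define W where "W = IGam_cdf_estimator X n b x"
  have rv [measurable]: "random_variable borel (X i)" if "i \<ge> 1" for i
    using ind that unfolding indep_vars_def2 by auto
  have [measurable]: "K \<in> borel_measurable borel"
    unfolding K_def using pos by measurable
  have K01: "0 \<le> K t" "K t \<le> 1" for t
    unfolding K_def using IGam_survival_bounds pos by auto
  \<comment> \<open>The observations are given only through a common distribution function; this
    determines the law, so every expectation can be taken under that of \<open>X 1\<close>.\<close>
  have distr: "distr M borel (X i) = \<mu>" if "i \<ge> 1" for i
    unfolding \<mu>_def
    by (rule cdf_unique) (use that in \<open>auto simp: cdf intro!: real_distribution_distr rv\<close>)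
  define Y where "Y = (\<lambda>i \<omega>. K (X i \<omega>))"
  have rvY [measurable]: "random_variable borel (Y i)" if "i \<in> {1..n}" for i
    unfolding Y_def using that by (intro measurable_compose[OF rv]) auto
  have BY: "\<bar>Y i \<omega>\<bar> \<le> 1" for i \<omega>
    using K01[of "X i \<omega>"] by (simp add: Y_def)
  have intY: "integrable M (Y i)" "integrable M (\<lambda>\<omega>. (Y i \<omega>)\<^sup>2)" if "i \<in> {1..n}" for i
    using integrable_bounded_powers[OF rvY[OF that] BY, of 1]
      integrable_bounded_powers[OF rvY[OF that] BY, of 2] by simp_all
  have EY: "expectation (Y i) = (\<integral>t. K t \<partial>\<mu>)" "expectation (\<lambda>\<omega>. (Y i \<omega>)\<^sup>2) = (\<integral>t. (K t)\<^sup>2 \<partial>\<mu>)"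
    if "i \<in> {1..n}" for i
  proof -
    have "i \<ge> 1" using that by simp
    then show "expectation (Y i) = (\<integral>t. K t \<partial>\<mu>)" "expectation (\<lambda>\<omega>. (Y i \<omega>)\<^sup>2) = (\<integral>t. (K t)\<^sup>2 \<partial>\<mu>)"
      unfolding Y_def distr[OF \<open>i \<ge> 1\<close>, symmetric] by (simp_all add: integral_distr[OF rv])
  qed
  have indY: "indep_vars (\<lambda>_. borel) Y {1..n}"
    unfolding Y_def
    by (rule indep_vars_compose2[OF indep_vars_subset[OF ind]]) auto
  have W: "W = (\<lambda>\<omega>. 1 / real n * (\<Sum>i=1..n. Y i \<omega>))"
    by (simp add: W_def IGam_cdf_estimator_def[abs_def] Y_def K_def)
  have [measurable]: "random_variable borel W"
    unfolding W by measurable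
  have "\<bar>W \<omega>\<bar> \<le> 1" for \<omega>
  proof -
    have "\<bar>\<Sum>i=1..n. Y i \<omega>\<bar> \<le> (\<Sum>i=1..n. 1)"
      using BY by (intro order_trans[OF sum_abs] sum_mono) auto
    then show ?thesis using pos by (simp add: W abs_mult divide_simps)
  qed
  then show "MSE M (IGam_cdf_estimator X n b x) \<theta>
      = variance (IGam_cdf_estimator X n b x) + (Bias M (IGam_cdf_estimator X n b x) \<theta>)\<^sup>2"
    by (intro MSE_eq_variance_Bias[where B = 1]) (simp_all flip: W_def)
  have EW: "expectation W = (\<integral>t. K t \<partial>\<mu>)"
    using intY EY pos unfolding W by (simp add: Bochner_Integration.integral_sum)
  then show "Bias M (IGam_cdf_estimator X n b x) \<theta> = (\<integral>t. K t \<partial>\<mu>) - \<theta>"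
    by (simp add: Bias_def W_def)
  have "variance W = expectation (\<lambda>\<omega>. (1 / real n)\<^sup>2 *
      ((\<Sum>i=1..n. Y i \<omega>) - expectation (\<lambda>\<omega>. \<Sum>i=1..n. Y i \<omega>))\<^sup>2)"
    unfolding W by (simp add: power_mult_distrib[symmetric] right_diff_distrib)
  also have "\<dots> = (1 / real n)\<^sup>2 * variance (\<lambda>\<omega>. \<Sum>i=1..n. Y i \<omega>)"
    by (rule integral_mult_right_zero)
  also have "variance (\<lambda>\<omega>. \<Sum>i=1..n. Y i \<omega>) = (\<Sum>i=1..n. variance (Y i))"
    by (rule variance_sum_indep[OF indY _ BY]) auto
  also have "\<dots> = (\<Sum>i=1..n. (\<integral>t. (K t)\<^sup>2 \<partial>\<mu>) - (\<integral>t. K t \<partial>\<mu>)\<^sup>2)"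
    using EY by (intro sum.cong refl) (subst variance_eq, auto intro!: intY)
  finally show "variance (IGam_cdf_estimator X n b x)
      = 1 / real n * ((\<integral>t. (K t)\<^sup>2 \<partial>\<mu>) - (\<integral>t. K t \<partial>\<mu>)\<^sup>2)"
    using pos by (simp add: power2_eq_square flip: W_def)
qed

section \<open>Expansion of the kernel moments for small bandwidth\<close>

text \<open>In the applications \<open>u\<close> is a weight times \<open>F\<close>,
  \<open>q\<close> the same weight times a Taylor polynomial, and \<open>r\<close> the remainder
  bound; \<open>Q\<close> and \<open>R\<close> are known from the moment formulas.\<close>

lemma integral_approx:
  fixes u q r :: "'a \<Rightarrow> real"
  assumes "integrable M u" "has_bochner_integral M q Q" "has_bochner_integral M r R"
    and "\<And>g. \<bar>u g - q g\<bar> \<le> r g"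
  shows "\<bar>(\<integral>g. u g \<partial>M) - Q\<bar> \<le> R"
proof -
  have "\<bar>(\<integral>g. u g \<partial>M) - Q\<bar> = \<bar>\<integral>g. u g - q g \<partial>M\<bar>"
    using assms by (auto simp: has_bochner_integral_iff)
  also have "\<dots> \<le> (\<integral>g. r g \<partial>M)"
    using assms by (intro order_trans[OF integral_abs_bound] integral_mono)
      (auto simp: has_bochner_integral_iff)
  finally show ?thesis using assms by (simp add: has_bochner_integral_iff)
qed

lemma abs_mult_le_mult: "0 \<le> p \<Longrightarrow> \<bar>d\<bar> \<le> r \<Longrightarrow> \<bar>p * d\<bar> \<le> p * r" for p d r :: real
  by (simp add: abs_mult mult_left_mono)

text \<open>The problem for the law of a single observation, free of \<open>n\<close> and of the
  bandwidth sequence; estimates proved here depend on the bandwidth only through \<open>b\<close>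
  itself.\<close>

locale smooth_cdf =
  fixes \<mu> :: "real measure" and F f f' :: "real \<Rightarrow> real" and x B :: real
  assumes \<mu>: "real_distribution \<mu>" and cdf_eq: "cdf \<mu> = F"
    and deriv1: "\<And>t. t \<ge> 0 \<Longrightarrow> (F has_real_derivative f t) (at t within {0..})"
    and deriv2: "\<And>t. t \<ge> 0 \<Longrightarrow> (f has_real_derivative f' t) (at t within {0..})"
    and cont: "continuous_on {0..} f'"
    and B: "\<And>t. t \<ge> 0 \<Longrightarrow> \<bar>f' t\<bar> \<le> B"
    and x: "x > 0"
begin

interpretation real_distribution \<mu> by (rule \<mu>)

lemma F_bounds: "0 \<le> F t" "F t \<le> 1"
  using cdf_nonneg[of t] cdf_bounded_prob[of t] by (simp_all add: cdf_eq)

lemma measurable_F [measurable]: "F \<in> borel_measurable borel"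
  unfolding cdf_eq[symmetric] by (intro borel_measurable_mono monoI cdf_nondecreasing)

lemma B_nonneg: "0 \<le> B"
  using B[of 0] by simp

text \<open>A distribution function is increasing. In the theorem this sharpens
  \<open>f x * f' x \<noteq> 0\<close> to \<open>f x > 0\<close>, without which the optimal
  bandwidth formula would make no sense.\<close>

lemma f_nonneg: "f x \<ge> 0"
proof (rule mono_on_imp_deriv_nonneg)
  show "mono_on {0..} F"
    unfolding cdf_eq[symmetric] by (intro mono_onI cdf_nondecreasing)
  have "at x within {0..} = at x"
    using x by (intro at_within_interior) auto
  then show "(F has_real_derivative f x) (at x)"
    using deriv1[of x] x by simp
qed (use x in auto)

section \<open>Taylor expansion of the distribution function at \<open>x\<close>\<close>

lemma taylor:
  assumes "s > 0"
  obtains \<xi> where "\<xi> > 0" "\<bar>\<xi> - x\<bar> \<le> \<bar>s - x\<bar>"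
    "F s = F x + f x * (s - x) + f' \<xi> / 2 * (s - x)\<^sup>2"
proof (cases "s = x")
  case True
  then show ?thesis using that[of x] x by simp
next
  case False
  \<comment> \<open>The derivatives are one-sided at 0 only, and the segment between
    \<open>s\<close> and \<open>x\<close> stays in the positive half-line.\<close>
  have at: "at t within {0..} = at t" if "t > 0" for t :: real
    using that by (intro at_within_interior) auto
  define diff where "diff = (\<lambda>m :: nat. if m = 0 then F else if m = 1 then f else f')"
  have "\<exists>t. (if s < x then s < t \<and> t < x else x < t \<and> t < s) \<and>
      F s = (\<Sum>m<2. (diff m x / fact m) * (s - x) ^ m) + (diff 2 t / fact 2) * (s - x) ^ 2"
  proof (rule Taylor[where a = "min s x" and b = "max s x"])
    show "\<forall>m t. m < 2 \<and> min s x \<le> t \<and> t \<le> max s x \<longrightarrow>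
        (diff m has_real_derivative diff (Suc m) t) (at t)"
    proof (intro allI impI)
      fix m :: nat and t assume "m < 2 \<and> min s x \<le> t \<and> t \<le> max s x"
      moreover from this have "t > 0" using assms x by auto
      ultimately show "(diff m has_real_derivative diff (Suc m) t) (at t)"
        using deriv1[of t] deriv2[of t] at[of t] by (auto simp: diff_def less_2_cases_iff)
    qed
  qed (use False in \<open>auto simp: diff_def\<close>)
  then obtain t where t: "if s < x then s < t \<and> t < x else x < t \<and> t < s"
    "F s = (\<Sum>m<2. (diff m x / fact m) * (s - x) ^ m) + (diff 2 t / fact 2) * (s - x) ^ 2"
    by blast
  show ?thesis
    using t assms x by (intro that[of t]) (auto simp: diff_def numeral_2_eq_2 split: if_splits)
qed

lemma taylor_bound:
  assumes "s > 0"
  shows "\<bar>F s - (F x + f x * (s - x))\<bar> \<le> B / 2 * (s - x)\<^sup>2"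
proof -
  obtain \<xi> where \<xi>: "\<xi> > 0" "F s = F x + f x * (s - x) + f' \<xi> / 2 * (s - x)\<^sup>2"
    using taylor[OF assms] .
  then have "\<bar>F s - (F x + f x * (s - x))\<bar> = \<bar>f' \<xi>\<bar> / 2 * (s - x)\<^sup>2"
    by (simp add: abs_mult)
  also have "\<dots> \<le> B / 2 * (s - x)\<^sup>2"
    using B[of \<xi>] \<xi>(1) by (intro mult_right_mono) auto
  finally show ?thesis .
qed

text \<open>Away from \<open>x\<close> the error of the second-order expansion is only quadratic, and is absorbed
  there by the fourth-order term.\<close>

lemma taylor_small_error:
  assumes "\<epsilon> > 0"
  obtains D where "\<And>s. s > 0 \<Longrightarrow>
    \<bar>F s - (F x + f x * (s - x) + f' x / 2 * (s - x)\<^sup>2)\<bar> \<le> \<epsilon> * (s - x)\<^sup>2 + D * (s - x) ^ 4"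
proof -
  have "continuous (at x within {0..}) f'"
    using cont x by (auto simp: continuous_on_eq_continuous_within)
  then obtain \<delta> where \<delta>: "\<delta> > 0" "\<And>t. t \<ge> 0 \<Longrightarrow> \<bar>t - x\<bar> < \<delta> \<Longrightarrow> \<bar>f' t - f' x\<bar> < \<epsilon>"
    using assms unfolding continuous_within_eps_delta dist_real_def by (metis atLeast_iff)
  show ?thesis
  \<comment> \<open>At distance at least \<open>\<delta>\<close> from \<open>x\<close>,
    \<open>(s - x)\<^sup>2\<close> is at most \<open>(s - x) ^ 4 / \<delta>\<^sup>2\<close>, and
    half the variation of \<open>f'\<close> is at most \<open>B\<close>.\<close>
  proof (rule that[of "B / \<delta>\<^sup>2"])
    fix s :: real assume "s > 0"
    then obtain \<xi> where \<xi>: "\<xi> > 0" "\<bar>\<xi> - x\<bar> \<le> \<bar>s - x\<bar>"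
      "F s = F x + f x * (s - x) + f' \<xi> / 2 * (s - x)\<^sup>2"
      using taylor by blast
    have "\<bar>F s - (F x + f x * (s - x) + f' x / 2 * (s - x)\<^sup>2)\<bar> = \<bar>(f' \<xi> - f' x) / 2 * (s - x)\<^sup>2\<bar>"
      unfolding \<xi>(3) by (rule arg_cong[where f = abs]) (simp add: field_simps)
    also have "\<dots> = \<bar>f' \<xi> - f' x\<bar> / 2 * (s - x)\<^sup>2"
      by (simp add: abs_mult)
    also have "\<dots> \<le> \<epsilon> * (s - x)\<^sup>2 + B / \<delta>\<^sup>2 * (s - x) ^ 4"
    proof (cases "\<bar>s - x\<bar> < \<delta>")
      case True
      then have "\<bar>f' \<xi> - f' x\<bar> / 2 * (s - x)\<^sup>2 \<le> \<epsilon> * (s - x)\<^sup>2"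
        using \<delta>(2)[of \<xi>] \<xi> by (intro mult_right_mono) auto
      then show ?thesis using B_nonneg by (auto intro: add_increasing2)
    next
      case False
      then have "\<delta>\<^sup>2 \<le> (s - x)\<^sup>2"
        using \<delta>(1) by (metis abs_le_square_iff abs_of_pos not_less)
      then have "(s - x)\<^sup>2 * \<delta>\<^sup>2 \<le> (s - x)\<^sup>2 * (s - x)\<^sup>2"
        by (intro mult_left_mono) auto
      then have "(s - x)\<^sup>2 \<le> (s - x) ^ 4 / \<delta>\<^sup>2"
        using \<delta>(1) by (simp add: divide_simps power4_eq_xxxx power2_eq_square mult.assoc)
      then have "B * (s - x)\<^sup>2 \<le> B * ((s - x) ^ 4 / \<delta>\<^sup>2)"
        using B_nonneg by (intro mult_left_mono)
      moreover have "\<bar>f' \<xi> - f' x\<bar> / 2 * (s - x)\<^sup>2 \<le> B * (s - x)\<^sup>2"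
        using B[of \<xi>] B[of x] \<xi>(1) x by (intro mult_right_mono) auto
      ultimately have "\<bar>f' \<xi> - f' x\<bar> / 2 * (s - x)\<^sup>2 \<le> B / \<delta>\<^sup>2 * (s - x) ^ 4"
        unfolding times_divide_eq_left times_divide_eq_right by (rule order_trans[rotated])
      then show ?thesis
        using assms by (auto intro: add_increasing)
    qed
    finally show "\<bar>F s - (F x + f x * (s - x) + f' x / 2 * (s - x)\<^sup>2)\<bar>
        \<le> \<epsilon> * (s - x)\<^sup>2 + B / \<delta>\<^sup>2 * (s - x) ^ 4" .
  qed
qed

section \<open>Mean, second moment and variance of the kernel at one observation\<close>

lemma integrable_mult_F:
  assumes "integrable lborel w"
  shows "integrable lborel (\<lambda>g. w g * F (c / g))"
proof (rule Bochner_Integration.integrable_bound[OF assms])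
  show "AE g in lborel. norm (w g * F (c / g)) \<le> norm (w g)"
    using F_bounds by (auto simp: abs_mult intro!: mult_left_le)
qed (use assms in measurable)

definition K :: "real \<Rightarrow> real \<Rightarrow> real" where
  "K b = IGam_survival (1 / b + 1) (b / x)"

lemma mean_K:
  assumes "b > 0"
  shows "(\<integral>t. K b t \<partial>\<mu>) = (\<integral>g. gamma_density (1 / b + 1) g * F (x / b / g) \<partial>lborel)"
    and "integrable lborel (\<lambda>g. gamma_density (1 / b + 1) g * F (x / b / g))"
proof -
  show "(\<integral>t. K b t \<partial>\<mu>) = (\<integral>g. gamma_density (1 / b + 1) g * F (x / b / g) \<partial>lborel)"
    using expectation_IGam_survival(1)[OF \<mu> assms x] by (simp add: K_def cdf_eq)
  show "integrable lborel (\<lambda>g. gamma_density (1 / b + 1) g * F (x / b / g))"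
    using has_bochner_integral_gamma_density[of "1 / b + 1"] assms
    by (intro integrable_mult_F) (simp add: has_bochner_integral_iff add_pos_pos)
qed

lemma mean_K_sq:
  assumes "b > 0"
  shows "(\<integral>t. (K b t)\<^sup>2 \<partial>\<mu>) = (\<integral>g. 2 * gamma_cdf (1 / b + 1) g * gamma_density (1 / b + 1) g
      * F (x / b / g) \<partial>lborel)"
    and "integrable lborel (\<lambda>g. 2 * gamma_cdf (1 / b + 1) g * gamma_density (1 / b + 1) g
      * F (x / b / g))"
proof -
  have s: "1 / b + 1 > 1" using assms by simp
  note [measurable] = measurable_gamma_cdf[OF s]
  show "(\<integral>t. (K b t)\<^sup>2 \<partial>\<mu>) = (\<integral>g. 2 * gamma_cdf (1 / b + 1) g * gamma_density (1 / b + 1) g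
      * F (x / b / g) \<partial>lborel)"
    using expectation_IGam_survival(2)[OF \<mu> assms x] by (simp add: K_def cdf_eq)
  show "integrable lborel (\<lambda>g. 2 * gamma_cdf (1 / b + 1) g * gamma_density (1 / b + 1) g
      * F (x / b / g))"
    using has_bochner_integral_gamma_max_density[OF s] by (intro integrable_mult_F) (simp add: has_bochner_integral_iff)
qed

text \<open>The threshold 1/4 gives \<open>1 / b \<ge> 4\<close>, enough for the fourth inverse
  moment, and makes the variance factor \<open>1 / (1 / b - 1)\<close>, equal to
  \<open>b / (1 - b)\<close>, at most \<open>2 * b\<close>.\<close>

lemma small_bandwidth:
  assumes "0 < b" "b \<le> 1/4"
  shows "1 / b > 3" "1 / b > 1" "x / b = 1 / b * x" "1 / (1 / b - 1) \<le> 2 * b"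
  using assms by (auto simp: divide_simps)

lemma has_bochner_integral_linear:
  assumes b: "0 < b" "b \<le> 1/4"
  shows "has_bochner_integral lborel
    (\<lambda>g. gamma_density (1 / b + 1) g * (F x + f x * (x / b / g - x))) (F x)"
proof -
  note sb = small_bandwidth[OF b]
  have "has_bochner_integral lborel
      (\<lambda>g. (F x - f x * x) * gamma_density (1 / b + 1) g
        + f x * (gamma_density (1 / b + 1) g * (x / b / g)))
      ((F x - f x * x) * 1 + f x * x)"
    by (intro has_bochner_integral_add has_bochner_integral_mult_right
        has_bochner_integral_gamma_density gamma_inverse_moments sb) (use sb in linarith)
  then show ?thesis by (simp add: algebra_simps)
qed

text \<open>The first-order term integrates to 0, leaving half of \<open>B\<close> times the
  variance of \<open>T\<close>. This is precise enough for the square of the mean inside the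
  variance; the exact coefficient of \<open>b\<close> matters only for the bias.\<close>

lemma mean_K_crude:
  assumes b: "0 < b" "b \<le> 1/4"
  shows "\<bar>(\<integral>t. K b t \<partial>\<mu>) - F x\<bar> \<le> B * x\<^sup>2 * b"
proof -
  note sb = small_bandwidth[OF b]
  have "\<bar>(\<integral>t. K b t \<partial>\<mu>) - F x\<bar> \<le> B / 2 * (x\<^sup>2 / (1 / b - 1))"
    unfolding mean_K(1)[OF b(1)]
  proof (rule integral_approx)
    show "has_bochner_integral lborel
        (\<lambda>g. B / 2 * (gamma_density (1 / b + 1) g * (x / b / g - x)\<^sup>2)) (B / 2 * (x\<^sup>2 / (1 / b - 1)))"
      by (intro has_bochner_integral_mult_right gamma_inverse_moments sb)
    fix g
    have "\<bar>gamma_density (1 / b + 1) g * (F (x / b / g) - (F x + f x * (x / b / g - x)))\<bar>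
        \<le> gamma_density (1 / b + 1) g * (B / 2 * (x / b / g - x)\<^sup>2)"
    proof (cases "g > 0")
      case True
      then show ?thesis
        using b x by (intro abs_mult_le_mult taylor_bound gamma_density_nonneg) (auto intro: add_pos_pos)
    qed (simp add: gamma_density_nonpos)
    then show "\<bar>gamma_density (1 / b + 1) g * F (x / b / g)
        - gamma_density (1 / b + 1) g * (F x + f x * (x / b / g - x))\<bar>
        \<le> B / 2 * (gamma_density (1 / b + 1) g * (x / b / g - x)\<^sup>2)"
      by (simp add: right_diff_distrib mult.left_commute)
  qed (use mean_K(2) has_bochner_integral_linear b in auto)
  also have "\<dots> = B / 2 * x\<^sup>2 * (1 / (1 / b - 1))" by simp
  also have "\<dots> \<le> B / 2 * x\<^sup>2 * (2 * b)"
    using sb(4) B_nonneg by (intro mult_left_mono) auto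
  finally show ?thesis by simp
qed

text \<open>The linear Taylor polynomial is integrated exactly against the density \<open>w\<close>
  of the maximum. For the quadratic error, \<open>w\<close> is at most twice the one-variable
  density, so the variance of a single \<open>T\<close> suffices. Finally the Gamma ratio
  \<open>R\<close> is replaced by \<open>b powr (1/2)\<close> at the cost of
  \<open>b\<close>.\<close>

lemma mean_K_sq_approx:
  assumes b: "0 < b" "b \<le> 1/4"
  shows "\<bar>(\<integral>t. (K b t)\<^sup>2 \<partial>\<mu>) - (F x - b powr (1/2) * (x * f x / sqrt pi))\<bar>
    \<le> (2 * B * x\<^sup>2 + x * f x / sqrt pi) * b"
proof -
  note sb = small_bandwidth[OF b]
  have s: "1 / b + 1 > 1" using b by simp
  define w where "w = (\<lambda>g. 2 * gamma_cdf (1 / b + 1) g * gamma_density (1 / b + 1) g)"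
  define R where "R = Gamma (1 / b + 1 / 2) / Gamma (1 / b + 1)"
  have "\<bar>(\<integral>t. (K b t)\<^sup>2 \<partial>\<mu>) - (F x - R * (x * f x / sqrt pi))\<bar> \<le> B * (x\<^sup>2 / (1 / b - 1))"
    unfolding mean_K_sq(1)[OF b(1)]
  proof (rule integral_approx)
    have "has_bochner_integral lborel (\<lambda>g. (F x - f x * x) * w g + f x * (w g * (x / b / g)))
        ((F x - f x * x) * 1 + f x * (x - x / sqrt pi * R))"
      unfolding w_def R_def
      by (intro has_bochner_integral_add has_bochner_integral_mult_right
          has_bochner_integral_gamma_max_density s
          gamma_inverse_min_moment sb)
    then show "has_bochner_integral lborel (\<lambda>g. w g * (F x + f x * (x / b / g - x)))
        (F x - R * (x * f x / sqrt pi))"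
      by (simp add: algebra_simps)
    show "has_bochner_integral lborel
        (\<lambda>g. B * (gamma_density (1 / b + 1) g * (x / b / g - x)\<^sup>2)) (B * (x\<^sup>2 / (1 / b - 1)))"
      by (intro has_bochner_integral_mult_right gamma_inverse_moments sb)
    show "integrable lborel (\<lambda>g. 2 * gamma_cdf (1 / b + 1) g * gamma_density (1 / b + 1) g
      * F (x / b / g))"
      using mean_K_sq(2) b by simp
    fix g
    have p: "0 \<le> gamma_density (1 / b + 1) g"
      using s by (intro gamma_density_nonneg) linarith
    then have w: "0 \<le> w g" "w g \<le> 2 * gamma_density (1 / b + 1) g"
      using gamma_cdf_nonneg[OF s, of g] gamma_cdf_le_1[OF s, of g] by (auto simp: w_def intro!: mult_left_le_one_le)
    have "\<bar>w g * (F (x / b / g) - (F x + f x * (x / b / g - x)))\<bar>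
        \<le> (2 * gamma_density (1 / b + 1) g) * (B / 2 * (x / b / g - x)\<^sup>2)"
    proof (cases "g > 0")
      case True
      then show ?thesis
        using b x taylor_bound[of "x / b / g"] w p
        unfolding abs_mult by (intro mult_mono) auto
    qed (simp add: gamma_density_nonpos w_def)
    then show "\<bar>2 * gamma_cdf (1 / b + 1) g * gamma_density (1 / b + 1) g * F (x / b / g)
        - w g * (F x + f x * (x / b / g - x))\<bar>
        \<le> B * (gamma_density (1 / b + 1) g * (x / b / g - x)\<^sup>2)"
      unfolding w_def[symmetric] by (simp add: right_diff_distrib mult_ac w_def)
  qed
  also have "\<dots> = B * x\<^sup>2 * (1 / (1 / b - 1))" by simp
  also have "\<dots> \<le> B * x\<^sup>2 * (2 * b)"
    using sb(4) B_nonneg by (intro mult_left_mono) auto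
  finally have 1: "\<bar>(\<integral>t. (K b t)\<^sup>2 \<partial>\<mu>) - (F x - R * (x * f x / sqrt pi))\<bar> \<le> 2 * B * x\<^sup>2 * b"
    by simp
  have "\<bar>R - b powr (1/2)\<bar> \<le> b"
    using Gamma_half_ratio_approx[of "1 / b"] b
    by (simp add: R_def powr_half_sqrt real_sqrt_divide)
  then have "\<bar>R - b powr (1/2)\<bar> * (x * f x / sqrt pi) \<le> b * (x * f x / sqrt pi)"
    using x f_nonneg by (intro mult_right_mono) auto
  then have "\<bar>(R - b powr (1/2)) * (x * f x / sqrt pi)\<bar> \<le> b * (x * f x / sqrt pi)"
    using x f_nonneg by (simp add: abs_mult)
  with 1 show ?thesis
    unfolding left_diff_distrib distrib_right abs_le_iff by (auto simp: mult.commute)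
qed

text \<open>Of the coefficient 4, one half stems from the second moment and the other from the
  squared mean: both \<open>m\<close> and \<open>F x\<close> lie in the unit interval, so their
  squares differ by at most twice their difference.\<close>

lemma variance_K_approx:
  assumes b: "0 < b" "b \<le> 1/4"
  shows "\<bar>((\<integral>t. (K b t)\<^sup>2 \<partial>\<mu>) - (\<integral>t. K b t \<partial>\<mu>)\<^sup>2)
      - (F x * (1 - F x) - b powr (1/2) * (x * f x / sqrt pi))\<bar>
    \<le> (4 * B * x\<^sup>2 + x * f x / sqrt pi) * b"
proof -
  define m where "m = (\<integral>t. K b t \<partial>\<mu>)"
  have [measurable]: "K b \<in> borel_measurable borel"
    unfolding K_def using b x by measurable
  have K01: "0 \<le> K b t" "K b t \<le> 1" for t
    using IGam_survival_bounds[OF b(1) x] by (auto simp: K_def)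
  have "integrable \<mu> (K b)"
    using K01 by (intro integrable_const_bound[where B = 1]) auto
  then have m: "0 \<le> m" "m \<le> 1"
    unfolding m_def using K01 by (auto intro!: integral_le_const Bochner_Integration.integral_nonneg)
  have "\<bar>m\<^sup>2 - (F x)\<^sup>2\<bar> = \<bar>m + F x\<bar> * \<bar>m - F x\<bar>"
    by (simp add: abs_mult[symmetric] power2_eq_square algebra_simps)
  also have "\<dots> \<le> 2 * (B * x\<^sup>2 * b)"
    using mean_K_crude[OF b] m F_bounds[of x] unfolding m_def[symmetric] by (intro mult_mono) auto
  finally have "\<bar>m\<^sup>2 - (F x)\<^sup>2\<bar> \<le> 2 * (B * x\<^sup>2 * b)" .
  with mean_K_sq_approx[OF b] show ?thesis
    unfolding m_def[symmetric] abs_le_iff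
    by (auto simp: algebra_simps power2_eq_square)
qed

lemma mean_K_fine:
  assumes b: "0 < b" "b \<le> 1/4"
    and D: "\<And>s. s > 0 \<Longrightarrow>
    \<bar>F s - (F x + f x * (s - x) + f' x / 2 * (s - x)\<^sup>2)\<bar> \<le> \<epsilon> * (s - x)\<^sup>2 + D * (s - x) ^ 4"
  shows "\<bar>(\<integral>t. K b t \<partial>\<mu>) - (F x + f' x / 2 * (x\<^sup>2 / (1 / b - 1)))\<bar>
    \<le> \<epsilon> * (x\<^sup>2 / (1 / b - 1))
      + D * (x ^ 4 * (3 * (1 / b) + 18) / ((1 / b - 1) * (1 / b - 2) * (1 / b - 3)))"
proof -
  note sb = small_bandwidth[OF b]
  note M = gamma_inverse_moments[OF sb(1,3)]
  show ?thesis
    unfolding mean_K(1)[OF b(1)]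
  proof (rule integral_approx)
    show "has_bochner_integral lborel
        (\<lambda>g. gamma_density (1 / b + 1) g * (F x + f x * (x / b / g - x))
          + f' x / 2 * (gamma_density (1 / b + 1) g * (x / b / g - x)\<^sup>2))
        (F x + f' x / 2 * (x\<^sup>2 / (1 / b - 1)))"
      by (intro has_bochner_integral_add has_bochner_integral_mult_right
          has_bochner_integral_linear b M)
    show "has_bochner_integral lborel
        (\<lambda>g. \<epsilon> * (gamma_density (1 / b + 1) g * (x / b / g - x)\<^sup>2)
          + D * (gamma_density (1 / b + 1) g * (x / b / g - x) ^ 4))
        (\<epsilon> * (x\<^sup>2 / (1 / b - 1))
          + D * (x ^ 4 * (3 * (1 / b) + 18) / ((1 / b - 1) * (1 / b - 2) * (1 / b - 3))))"
      by (intro has_bochner_integral_add has_bochner_integral_mult_right M)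
    fix g
    let ?p = "gamma_density (1 / b + 1) g" and ?s = "x / b / g"
    have "\<bar>?p * (F ?s - (F x + f x * (?s - x) + f' x / 2 * (?s - x)\<^sup>2))\<bar>
        \<le> ?p * (\<epsilon> * (?s - x)\<^sup>2 + D * (?s - x) ^ 4)"
    proof (cases "g > 0")
      case True
      then show ?thesis
        using b x by (intro abs_mult_le_mult D gamma_density_nonneg) (auto intro: add_pos_pos)
    qed (simp add: gamma_density_nonpos)
    then show "\<bar>?p * F ?s - (?p * (F x + f x * (?s - x)) + f' x / 2 * (?p * (?s - x)\<^sup>2))\<bar>
        \<le> \<epsilon> * (?p * (?s - x)\<^sup>2) + D * (?p * (?s - x) ^ 4)"
      by (simp only: distrib_left right_diff_distrib mult.left_commute[of ?p])
  qed (use mean_K(2) b in auto)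
qed

text \<open>The coefficient is half of \<open>f' x\<close> times the limit of the variance of
  \<open>T\<close> over \<open>b\<close>. Squaring this limit later yields the
  \<open>b\<^sup>2\<close> term of the error together with its o-remainder.\<close>

lemma bias_limit: "((\<lambda>b. ((\<integral>t. K b t \<partial>\<mu>) - F x) / b) \<longlongrightarrow> f' x / 2 * x\<^sup>2) (at_right 0)"
proof (rule tendstoI)
  fix e :: real assume e: "e > 0"
  \<comment> \<open>Chosen so that the bound \<open>r\<close> tends to \<open>e / 2\<close>;
    \<open>D\<close> depends on \<open>\<epsilon>\<close> but not on \<open>b\<close>.\<close>
  define \<epsilon> where "\<epsilon> = e / (2 * x\<^sup>2)"
  have "\<epsilon> > 0" using e x by (simp add: \<epsilon>_def)
  from taylor_small_error[OF this] obtain D where D: "\<And>s. s > 0 \<Longrightarrow>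
    \<bar>F s - (F x + f x * (s - x) + f' x / 2 * (s - x)\<^sup>2)\<bar> \<le> \<epsilon> * (s - x)\<^sup>2 + D * (s - x) ^ 4" by blast
  \<comment> \<open>The three summands come from the \<open>\<epsilon>\<close>-part of the Taylor
    error, its fourth-order part, and the replacement of the exact variance of \<open>T\<close> by
    \<open>x\<^sup>2 * b\<close>.\<close>
  define r where "r = (\<lambda>b :: real. \<epsilon> * x\<^sup>2 * (1 / (1 / b - 1) / b)
    + D * x ^ 4 * ((3 * (1 / b) + 18) / ((1 / b - 1) * (1 / b - 2) * (1 / b - 3)) / b)
    + \<bar>f' x / 2 * x\<^sup>2\<bar> * \<bar>1 / (1 / b - 1) / b - 1\<bar>)"
  have lim: "((\<lambda>b :: real. 1 / (1 / b - 1) / b) \<longlongrightarrow> 1) (at_right 0)"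
    "((\<lambda>b :: real. (3 * (1 / b) + 18) / ((1 / b - 1) * (1 / b - 2) * (1 / b - 3)) / b) \<longlongrightarrow> 0) (at_right 0)"
    by real_asymp+
  have "(r \<longlongrightarrow> \<epsilon> * x\<^sup>2 * 1 + D * x ^ 4 * 0 + \<bar>f' x / 2 * x\<^sup>2\<bar> * \<bar>1 - 1\<bar>) (at_right 0)"
    unfolding r_def by (intro tendsto_intros lim)
  moreover have "\<epsilon> * x\<^sup>2 * 1 + D * x ^ 4 * 0 + \<bar>f' x / 2 * x\<^sup>2\<bar> * \<bar>1 - 1\<bar> < e"
    using e x by (simp add: \<epsilon>_def)
  ultimately have "\<forall>\<^sub>F b in at_right 0. r b < e"
    by (rule order_tendstoD)
  moreover have "\<forall>\<^sub>F b :: real in at_right 0. 0 < b \<and> b < 1/4"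
    using eventually_at_right_real[of 0 "1/4"] by simp
  ultimately show "\<forall>\<^sub>F b in at_right 0. dist (((\<integral>t. K b t \<partial>\<mu>) - F x) / b) (f' x / 2 * x\<^sup>2) < e"
  proof eventually_elim
    case (elim b)
    define v where "v = 1 / (1 / b - 1)"
    define q where "q = (3 * (1 / b) + 18) / ((1 / b - 1) * (1 / b - 2) * (1 / b - 3))"
    define m where "m = (\<integral>t. K b t \<partial>\<mu>) - F x"
    define k where "k = f' x / 2 * x\<^sup>2"
    have b: "0 < b" "b \<le> 1/4" using elim by auto
    have "\<bar>m - k * v\<bar> \<le> \<epsilon> * x\<^sup>2 * v + D * x ^ 4 * q"
      using mean_K_fine[OF b D] by (simp add: m_def v_def q_def k_def)
    then have "\<bar>m - k * v\<bar> / b \<le> (\<epsilon> * x\<^sup>2 * v + D * x ^ 4 * q) / b"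
      using b by (intro divide_right_mono) auto
    moreover have "\<bar>m / b - k\<bar> \<le> \<bar>m - k * v\<bar> / b + \<bar>k\<bar> * \<bar>v / b - 1\<bar>"
    proof -
      have "m / b - k = (m - k * v) / b + k * (v / b - 1)"
        using b by (simp add: field_simps)
      also have "\<bar>\<dots>\<bar> \<le> \<bar>(m - k * v) / b\<bar> + \<bar>k * (v / b - 1)\<bar>"
        by (rule abs_triangle_ineq)
      finally show ?thesis using b by (simp add: abs_mult)
    qed
    ultimately have "\<bar>m / b - k\<bar> \<le> r b"
      unfolding r_def v_def[symmetric] q_def[symmetric] k_def[symmetric] by (simp add: add_divide_distrib)
    with elim show ?case by (simp add: dist_real_def m_def k_def)
  qed
qed

end

section \<open>The optimal bandwidth\<close>

text \<open>At the critical point the difference of values has a double root; its cofactor is a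
  positive quadratic form, which gives both global minimality and uniqueness.\<close>

lemma quartic_minus_linear_min:
  fixes q p u u\<^sub>0 :: real
  assumes "q > 0" "u > 0" "u\<^sub>0 > 0" and crit: "4 * q * u\<^sub>0 ^ 3 = p"
  shows "q * u\<^sub>0 ^ 4 - p * u\<^sub>0 \<le> q * u ^ 4 - p * u"
    and "q * u ^ 4 - p * u \<le> q * u\<^sub>0 ^ 4 - p * u\<^sub>0 \<Longrightarrow> u = u\<^sub>0"
proof -
  have eq: "(q * u ^ 4 - p * u) - (q * u\<^sub>0 ^ 4 - p * u\<^sub>0) = q * (u - u\<^sub>0)\<^sup>2 * (u\<^sup>2 + 2 * u * u\<^sub>0 + 3 * u\<^sub>0\<^sup>2)"
    unfolding crit[symmetric] by algebra
  have pos: "u\<^sup>2 + 2 * u * u\<^sub>0 + 3 * u\<^sub>0\<^sup>2 > 0"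
    using assms by (intro add_pos_pos) auto
  show "q * u\<^sub>0 ^ 4 - p * u\<^sub>0 \<le> q * u ^ 4 - p * u"
  proof -
    have "0 \<le> q * (u - u\<^sub>0)\<^sup>2 * (u\<^sup>2 + 2 * u * u\<^sub>0 + 3 * u\<^sub>0\<^sup>2)"
      using assms(1) pos by (intro mult_nonneg_nonneg) auto
    then show ?thesis using eq by linarith
  qed
  assume "q * u ^ 4 - p * u \<le> q * u\<^sub>0 ^ 4 - p * u\<^sub>0"
  then have "q * (u - u\<^sub>0)\<^sup>2 * (u\<^sup>2 + 2 * u * u\<^sub>0 + 3 * u\<^sub>0\<^sup>2) \<le> 0"
    using eq by simp
  then have "q * (u - u\<^sub>0)\<^sup>2 \<le> 0"
    using pos by (simp add: mult_le_0_iff)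
  then show "u = u\<^sub>0"
    using assms(1) by (simp add: mult_le_0_iff)
qed

lemma IGam_leading_MSE_optimum:
  fixes F f f' :: "real \<Rightarrow> real"
  assumes x: "x > 0" and f: "f x > 0" and f': "f' x \<noteq> 0" and n: "n \<ge> 1"
  shows "IGam_b_opt f f' x n > 0"
    and "is_arg_min (IGam_leading_MSE F f f' x n) (\<lambda>b. b > 0) b \<longleftrightarrow> b = IGam_b_opt f f' x n"
    and "IGam_leading_MSE F f f' x n (IGam_b_opt f f' x n) = 1 / real n * (F x * (1 - F x))
      - real n powr (- 4 / 3) * (3 / 4)
        * ((x * f x / sqrt pi) ^ 4 / (4 * (x ^ 4 / 4 * (f' x)\<^sup>2))) powr (1 / 3)"
proof -
  define p where "p = x * f x / sqrt pi"
  define q where "q = x ^ 4 / 4 * (f' x)\<^sup>2"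
  \<comment> \<open>The critical point in the variable \<open>sqrt b\<close>: the solution of
    \<open>4 * q * u ^ 3 = p / real n\<close>.\<close>
  define u\<^sub>0 where "u\<^sub>0 = (p / (4 * q * real n)) powr (1 / 3)"
  have pq: "p > 0" "q > 0" using assms by (auto simp: p_def q_def)
  have u0: "u\<^sub>0 > 0" using pq n by (simp add: u\<^sub>0_def)
  have u0_cube: "u\<^sub>0 ^ 3 = p / (4 * q * real n)"
    using pq n by (simp add: u\<^sub>0_def powr_realpow[symmetric] powr_powr)
  have crit: "4 * q * u\<^sub>0 ^ 3 = p / real n"
    using pq n by (simp add: u0_cube field_simps)
  have opt: "IGam_b_opt f f' x n = u\<^sub>0\<^sup>2"
  proof -
    have "u\<^sub>0\<^sup>2 = (p / (4 * q * real n)) powr (2 / 3)"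
      using pq n by (simp add: u\<^sub>0_def powr_realpow[symmetric] powr_powr)
    also have "\<dots> = (real n * (4 * q / p)) powr (- 2 / 3)"
    proof -
      have "p / (4 * q * real n) = inverse (real n * (4 * q / p))"
        using pq n by (simp add: field_simps)
      then show ?thesis
        using powr_minus[of "real n * (4 * q / p)" "2 / 3"] by (simp only: inverse_powr minus_divide_left)
    qed
    also have "\<dots> = real n powr (- 2 / 3) * (4 * q / p) powr (- 2 / 3)"
      using pq n by (intro powr_mult)
    finally show ?thesis
      by (simp add: IGam_b_opt_def p_def q_def)
  qed
  show "IGam_b_opt f f' x n > 0" using u0 opt by simp
  define A where "A = 1 / real n * (F x * (1 - F x))"
  \<comment> \<open>In \<open>u = sqrt b\<close> the leading part is a quartic minus a linear term.\<close>
  have lead: "IGam_leading_MSE F f f' x n (u\<^sup>2) = A + (q * u ^ 4 - p / real n * u)" if "u > 0" for u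
  proof -
    have "(u\<^sup>2) powr (1 / 2) = u"
      using that by (simp add: powr_half_sqrt)
    moreover have "(u\<^sup>2)\<^sup>2 = u ^ 4" by simp
    ultimately show ?thesis
      unfolding IGam_leading_MSE_def A_def p_def[symmetric] q_def[symmetric] by simp
  qed
  have sq: "b = (sqrt b)\<^sup>2" "sqrt b > 0" if "b > 0" for b :: real
    using that by auto
  note mn = quartic_minus_linear_min[OF pq(2) _ u0 crit]
  show "is_arg_min (IGam_leading_MSE F f f' x n) (\<lambda>b. b > 0) b \<longleftrightarrow> b = IGam_b_opt f f' x n"
  proof
    assume *: "is_arg_min (IGam_leading_MSE F f f' x n) (\<lambda>b. b > 0) b"
    then have b: "b > 0" by (simp add: is_arg_min_def)
    have "IGam_leading_MSE F f f' x n b \<le> IGam_leading_MSE F f f' x n (u\<^sub>0\<^sup>2)"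
      using * u0 by (simp add: is_arg_min_linorder)
    then have "sqrt b = u\<^sub>0"
      using mn(2)[of "sqrt b"] lead[OF u0] lead[OF sq(2)[OF b]] sq[OF b] by simp
    then show "b = IGam_b_opt f f' x n"
      using sq(1)[OF b] opt by simp
  next
    assume b: "b = IGam_b_opt f f' x n"
    have "IGam_leading_MSE F f f' x n b \<le> IGam_leading_MSE F f f' x n y" if "y > 0" for y
      using mn(1)[of "sqrt y"] lead[OF u0] lead[OF sq(2)[OF that]] sq[OF that] b opt by simp
    then show "is_arg_min (IGam_leading_MSE F f f' x n) (\<lambda>b. b > 0) b"
      using b opt u0 by (simp add: is_arg_min_linorder)
  qed
  have "IGam_leading_MSE F f f' x n (u\<^sub>0\<^sup>2) = A + u\<^sub>0 * (q * u\<^sub>0 ^ 3 - p / real n)"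
    unfolding lead[OF u0] by (simp add: algebra_simps power4_eq_xxxx power3_eq_cube)
  \<comment> \<open>By the critical equation the quartic term is a quarter of the linear one in
    absolute value; hence the factor 3/4.\<close>
  also have "q * u\<^sub>0 ^ 3 - p / real n = - (3 / 4) * (p / real n)"
    using crit by simp
  also have "A + u\<^sub>0 * (- (3 / 4) * (p / real n)) = A - (3 / 4) * (p / real n * u\<^sub>0)"
    by simp
  also have "p / real n * u\<^sub>0 = real n powr (- 4 / 3) * (p ^ 4 / (4 * q)) powr (1 / 3)"
  proof -
    \<comment> \<open>Both sides are nonnegative, so comparing cubes avoids manipulating fractional
      powers.\<close>
    have "(p / real n * u\<^sub>0) ^ 3 = p ^ 4 / (4 * q) / real n ^ 4"
      unfolding power_mult_distrib u0_cube
      using pq n by (simp add: power_divide power4_eq_xxxx power3_eq_cube)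
    also have "\<dots> = (real n powr (- 4 / 3) * (p ^ 4 / (4 * q)) powr (1 / 3)) ^ 3"
    proof -
      have "(real n powr (- 4 / 3)) ^ 3 = 1 / real n ^ 4"
        using n by (simp add: powr_power powr_neg_numeral)
      moreover have "((p ^ 4 / (4 * q)) powr (1 / 3)) ^ 3 = p ^ 4 / (4 * q)"
        using pq by (simp add: powr_power)
      ultimately show ?thesis by (simp add: power_mult_distrib)
    qed
    finally show ?thesis
      by (rule power_eq_imp_eq_base) (use pq u0 in auto)
  qed
  finally show "IGam_leading_MSE F f f' x n (IGam_b_opt f f' x n) = 1 / real n * (F x * (1 - F x))
      - real n powr (- 4 / 3) * (3 / 4)
        * ((x * f x / sqrt pi) ^ 4 / (4 * (x ^ 4 / 4 * (f' x)\<^sup>2))) powr (1 / 3)"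
    unfolding opt A_def p_def[symmetric] q_def[symmetric] by simp
qed

theorem corollary5p2:
  fixes M :: "'a measure" and X :: "nat \<Rightarrow> 'a \<Rightarrow> real"
    and F f f' :: "real \<Rightarrow> real" and x :: real
  assumes prob: "prob_space M"
    and indep: "prob_space.indep_vars M (\<lambda>_. borel) X {1..}"
    and cdf: "\<And>i. i \<ge> 1 \<Longrightarrow> cdf (distr M borel (X i)) = F"
    and supp: "\<And>t. t < 0 \<Longrightarrow> F t = 0"
    and deriv1: "\<And>t. t \<ge> 0 \<Longrightarrow> (F has_real_derivative f t) (at t within {0..})"
    and deriv2: "\<And>t. t \<ge> 0 \<Longrightarrow> (f has_real_derivative f' t) (at t within {0..})"
    and cont: "continuous_on {0..} f" "continuous_on {0..} f'"
    and bdd: "bounded (f ` {0..})" "bounded (f' ` {0..})"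
    and x: "x > 0"
  shows
    "(\<exists>C. \<forall>b :: nat \<Rightarrow> real. (\<forall>n\<ge>1. b n > 0) \<and> b \<longlonglongrightarrow> 0 \<longrightarrow>
        (\<forall>n\<ge>1. MSE M (IGam_cdf_estimator X n (b n) x) (F x)
             = prob_space.variance M (IGam_cdf_estimator X n (b n) x)
               + (Bias M (IGam_cdf_estimator X n (b n) x) (F x))\<^sup>2) \<and>
        (\<exists>R1 R2 :: nat \<Rightarrow> real.
            (\<forall>n\<ge>1. MSE M (IGam_cdf_estimator X n (b n) x) (F x)
                 = IGam_leading_MSE F f f' x n (b n) + R1 n + R2 n) \<and>
            (\<forall>\<^sub>F n in sequentially. \<bar>R1 n\<bar> \<le> C * (1 / real n * b n)) \<and>
            R2 \<in> o(\<lambda>n. (b n)\<^sup>2)))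
     \<and>
     (f x * f' x \<noteq> 0 \<longrightarrow>
        (\<forall>n\<ge>1. \<forall>b. is_arg_min (IGam_leading_MSE F f f' x n) (\<lambda>b. b > 0) b
             \<longleftrightarrow> b = IGam_b_opt f f' x n) \<and>
        (\<lambda>n. MSE M (IGam_cdf_estimator X n (IGam_b_opt f f' x n) x) (F x)
             - (1 / real n * (F x * (1 - F x))
                - real n powr (- 4 / 3) * (3 / 4)
                  * ((x * f x / sqrt pi) ^ 4 / (4 * (x ^ 4 / 4 * (f' x)\<^sup>2))) powr (1 / 3)))
          \<in> o(\<lambda>n. real n powr (- 4 / 3)))"
proof -
  interpret prob_space M by (rule prob)
  obtain B where B: "\<And>t. t \<ge> 0 \<Longrightarrow> \<bar>f' t\<bar> \<le> B"
    using bdd(2) by (auto simp: bounded_iff)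
  have rv: "random_variable borel (X 1)"
    using indep unfolding indep_vars_def2 by auto
  define \<mu> where "\<mu> = distr M borel (X 1)"
  interpret smooth_cdf \<mu> F f f' x B
  proof (rule smooth_cdf.intro)
    show "real_distribution \<mu>"
      unfolding \<mu>_def using rv by (rule real_distribution_distr)
    show "Distribution_Functions.cdf \<mu> = F"
      unfolding \<mu>_def by (rule cdf) simp
  qed (fact deriv1 deriv2 cont(2) B x)+
  have "\<forall>i\<ge>1. Distribution_Functions.cdf (distr M borel (X i)) = F"
    using cdf by blast
  note est = IGam_cdf_estimator_moments[OF indep this _ x, folded \<mu>_def]
  \<comment> \<open>This constant involves only \<open>x\<close>, \<open>f x\<close> and the bound
    \<open>B\<close> on \<open>f'\<close>, so it serves all bandwidth sequences at once.\<close>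
  define C where "C = 4 * B * x\<^sup>2 + x * f x / sqrt pi"
  \<comment> \<open>The limit of bias over \<open>b\<close>; its square is the coefficient of
    \<open>b\<^sup>2\<close> in the expansion.\<close>
  define k where "k = f' x / 2 * x\<^sup>2"
  have k: "k\<^sup>2 = x ^ 4 / 4 * (f' x)\<^sup>2"
    by (simp add: k_def power_mult_distrib power_divide)
  have expansion: "\<exists>R1 R2 :: nat \<Rightarrow> real.
      (\<forall>n\<ge>1. MSE M (IGam_cdf_estimator X n (b n) x) (F x)
           = IGam_leading_MSE F f f' x n (b n) + R1 n + R2 n) \<and>
      (\<forall>\<^sub>F n in sequentially. \<bar>R1 n\<bar> \<le> C * (1 / real n * b n)) \<and>
      R2 \<in> o(\<lambda>n. (b n)\<^sup>2)"
    if "\<forall>n\<ge>1. b n > 0" "b \<longlonglongrightarrow> 0" for b :: "nat \<Rightarrow> real"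
  proof -
    have b: "\<And>n. n \<ge> 1 \<Longrightarrow> b n > 0" "b \<longlonglongrightarrow> 0" using that by auto
    define m where "m = (\<lambda>n. \<integral>t. K (b n) t \<partial>\<mu>)"
    define V where "V = (\<lambda>n. (\<integral>t. (K (b n) t)\<^sup>2 \<partial>\<mu>) - (m n)\<^sup>2)"
    \<comment> \<open>All of the variance error goes into \<open>R1\<close> and all of the
      squared-bias error into \<open>R2\<close>, which makes the decomposition exact for every
      \<open>n \<ge> 1\<close>.\<close>
    define R1 where "R1 = (\<lambda>n. 1 / real n * (V n - (F x * (1 - F x) - b n powr (1/2) * (x * f x / sqrt pi))))"
    define R2 where "R2 = (\<lambda>n. (m n - F x)\<^sup>2 - (b n)\<^sup>2 * k\<^sup>2)"
    have "MSE M (IGam_cdf_estimator X n (b n) x) (F x)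
        = IGam_leading_MSE F f f' x n (b n) + R1 n + R2 n" if n: "n \<ge> 1" for n
    proof -
      have "MSE M (IGam_cdf_estimator X n (b n) x) (F x) = 1 / real n * V n + (m n - F x)\<^sup>2"
        using est(1)[OF b(1)[OF n] n] est(2,3)[OF b(1)[OF n] n]
        by (simp add: V_def m_def K_def)
      then show ?thesis
        by (simp add: IGam_leading_MSE_def R1_def R2_def k algebra_simps)
    qed
    moreover have "\<forall>\<^sub>F n in sequentially. \<bar>R1 n\<bar> \<le> C * (1 / real n * b n)"
    proof -
      have "\<forall>\<^sub>F n in sequentially. b n < 1/4"
        using b(2) by (rule order_tendstoD) simp
      then show ?thesis
        using eventually_ge_at_top[of 1]
      proof eventually_elim
        case (elim n)
        then have "\<bar>V n - (F x * (1 - F x) - b n powr (1/2) * (x * f x / sqrt pi))\<bar> \<le> C * b n"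
          using variance_K_approx[of "b n"] b(1)[of n] by (simp add: V_def m_def C_def)
        then have "1 / real n * \<bar>V n - (F x * (1 - F x) - b n powr (1/2) * (x * f x / sqrt pi))\<bar>
            \<le> 1 / real n * (C * b n)"
          by (intro mult_left_mono) auto
        then show ?case
          by (simp add: R1_def abs_mult mult.left_commute)
      qed
    qed
    moreover have "R2 \<in> o(\<lambda>n. (b n)\<^sup>2)"
    proof (rule smalloI_tendsto)
      have ev: "\<forall>\<^sub>F n in sequentially. b n > 0"
        using eventually_ge_at_top[of 1] by eventually_elim (use b in auto)
      then show "\<forall>\<^sub>F n in sequentially. (b n)\<^sup>2 \<noteq> 0"
        by eventually_elim auto
      \<comment> \<open>Positivity of the bandwidths turns convergence to 0 into approach from the
        right, as \<open>bias_limit\<close> requires.\<close>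
      have "filterlim b (at_right 0) sequentially"
        using b(2) ev by (simp add: tendsto_imp_filterlim_at_right)
      then have "(\<lambda>n. (m n - F x) / b n) \<longlonglongrightarrow> k"
        unfolding m_def k_def by (rule filterlim_compose[OF bias_limit])
      then have "(\<lambda>n. ((m n - F x) / b n)\<^sup>2 - k\<^sup>2) \<longlonglongrightarrow> k\<^sup>2 - k\<^sup>2"
        by (intro tendsto_intros)
      moreover have "\<forall>\<^sub>F n in sequentially. ((m n - F x) / b n)\<^sup>2 - k\<^sup>2 = R2 n / (b n)\<^sup>2"
        using ev by eventually_elim (simp add: R2_def field_simps)
      ultimately show "(\<lambda>n. R2 n / (b n)\<^sup>2) \<longlonglongrightarrow> 0"
        by (simp add: filterlim_cong)
    qed
    ultimately show ?thesis by blast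
  qed
  have optimum: "(\<forall>n\<ge>1. \<forall>b. is_arg_min (IGam_leading_MSE F f f' x n) (\<lambda>b. b > 0) b
             \<longleftrightarrow> b = IGam_b_opt f f' x n) \<and>
        (\<lambda>n. MSE M (IGam_cdf_estimator X n (IGam_b_opt f f' x n) x) (F x)
             - (1 / real n * (F x * (1 - F x))
                - real n powr (- 4 / 3) * (3 / 4)
                  * ((x * f x / sqrt pi) ^ 4 / (4 * (x ^ 4 / 4 * (f' x)\<^sup>2))) powr (1 / 3)))
          \<in> o(\<lambda>n. real n powr (- 4 / 3))" (is "?opt \<and> ?err \<in> _")
    if "f x * f' x \<noteq> 0"
  proof
    have f: "f x > 0" "f' x \<noteq> 0"
      using that f_nonneg by (auto simp: less_le)
    note opt = IGam_leading_MSE_optimum[where x = x and f = f and f' = f', OF x f]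
    show ?opt using opt(2) by blast
    define c where "c = (4 * (x ^ 4 / 4 * (f' x)\<^sup>2) / (x * f x / sqrt pi)) powr (- 2 / 3)"
    define b where "b = IGam_b_opt f f' x"
    have b: "b = (\<lambda>n. real n powr (- 2 / 3) * c)"
      by (simp add: b_def c_def IGam_b_opt_def[abs_def])
    have bO: "b \<in> O(\<lambda>n. real n powr (- 2 / 3))"
      unfolding b by simp
    have "(\<lambda>n. real n powr (- 2 / 3)) \<longlonglongrightarrow> 0"
      by real_asymp
    then have "b \<longlonglongrightarrow> 0"
      unfolding b by (rule tendsto_mult_left_zero)
    then obtain R1 R2 where R: "\<And>n. n \<ge> 1 \<Longrightarrow> MSE M (IGam_cdf_estimator X n (b n) x) (F x)
        = IGam_leading_MSE F f f' x n (b n) + R1 n + R2 n"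
      "\<forall>\<^sub>F n in sequentially. \<bar>R1 n\<bar> \<le> C * (1 / real n * b n)" "R2 \<in> o(\<lambda>n. (b n)\<^sup>2)"
    proof -
      have "\<forall>n\<ge>1. b n > 0"
        using opt(1) by (simp add: b_def)
      from expansion[OF this \<open>b \<longlonglongrightarrow> 0\<close>] show ?thesis
        by (elim exE conjE) (rule that, blast+)
    qed
    have "\<forall>\<^sub>F n in sequentially. norm (R1 n) \<le> C * norm (1 / real n * b n)"
      using R(2) eventually_ge_at_top[of 1]
      by eventually_elim (use opt(1) in \<open>auto simp: b_def abs_mult abs_of_pos\<close>)
    then have "R1 \<in> O(\<lambda>n. 1 / real n * b n)"
      by (rule bigoI)
    \<comment> \<open>At the optimum \<open>b\<close> has order \<open>n powr (- 2 / 3)\<close>: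
      \<open>R1\<close> is then of order at most \<open>n powr (- 5 / 3)\<close>, and
      \<open>b\<^sup>2\<close> has exactly the target order, so it is the o-bound on
      \<open>R2\<close> that is needed.\<close>
    also have "(\<lambda>n. 1 / real n * b n) \<in> O(\<lambda>n. 1 / real n * real n powr (- 2 / 3))"
      by (intro landau_o.big.mult bO) simp
    also have "(\<lambda>n. 1 / real n * real n powr (- 2 / 3)) \<in> o(\<lambda>n. real n powr (- 4 / 3))"
      by real_asymp
    finally have R1: "R1 \<in> o(\<lambda>n. real n powr (- 4 / 3))" .
    have "(\<lambda>n. (b n)\<^sup>2) \<in> O(\<lambda>n. (real n powr (- 2 / 3))\<^sup>2)"
      by (intro landau_o.big_power bO)
    also have "(\<lambda>n. (real n powr (- 2 / 3))\<^sup>2) \<in> O(\<lambda>n. real n powr (- 4 / 3))"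
      by real_asymp
    finally have "R2 \<in> o(\<lambda>n. real n powr (- 4 / 3))"
      by (rule landau_o.small_big_trans[OF R(3)])
    with R1 have "(\<lambda>n. R1 n + R2 n) \<in> o(\<lambda>n. real n powr (- 4 / 3))"
      by (rule sum_in_smallo)
    moreover have "\<forall>\<^sub>F n in sequentially. ?err n = R1 n + R2 n"
      using eventually_ge_at_top[of 1]
    proof eventually_elim
      case (elim n)
      then show ?case
        using R(1)[OF elim] opt(3)[OF elim] by (simp add: b_def)
    qed
    ultimately show "?err \<in> o(\<lambda>n. real n powr (- 4 / 3))"
      by (simp add: landau_o.small.in_cong)
  qed
  show ?thesis
  proof (intro conjI exI[of _ C] allI impI)
    fix b :: "nat \<Rightarrow> real" and n :: nat
    assume "(\<forall>n\<ge>1. b n > 0) \<and> b \<longlonglongrightarrow> 0" "n \<ge> 1"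
    then show "MSE M (IGam_cdf_estimator X n (b n) x) (F x)
             = variance (IGam_cdf_estimator X n (b n) x)
               + (Bias M (IGam_cdf_estimator X n (b n) x) (F x))\<^sup>2"
      using est(1)[of "b n" n "F x"] by blast
  next
    show "\<exists>R1 R2 :: nat \<Rightarrow> real.
      (\<forall>n\<ge>1. MSE M (IGam_cdf_estimator X n (b n) x) (F x)
           = IGam_leading_MSE F f f' x n (b n) + R1 n + R2 n) \<and>
      (\<forall>\<^sub>F n in sequentially. \<bar>R1 n\<bar> \<le> C * (1 / real n * b n)) \<and>
      R2 \<in> o(\<lambda>n. (b n)\<^sup>2)"
      if "(\<forall>n\<ge>1. b n > 0) \<and> b \<longlonglongrightarrow> 0" for b :: "nat \<Rightarrow> real"
      using that by (intro expansion) simp_all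
  qed (rule optimum[THEN conjunct1, rule_format] optimum[THEN conjunct2]; assumption)+
qed

end
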